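(* Let $F\in\mathbb Z[x]$ satisfy $M_{15}(F)=3^2m$ or $M_{15}(F)=5^2m$ for some integer $m$ with $\gcd(15,m)=1$. Then either $N_{15}(F)$ is 15-norm good, or $p\mid N_3(F)$ for some prime $p\equiv 7$ or $13\pmod{15}$, or $p\mid N_5(F)$ for some prime $p\equiv 11\pmod{15}$.
   Context: $\omega_d=e^{2\pi i/d}$; $M_{15}(F)=\prod_{j=1}^{15}F(\omega_{15}^j)$ and $N_d(F)=\prod_{1\le j\le d,\gcd(j,d)=1}F(\omega_d^j)$; $\Phi_d$ is the $d$-th cyclotomic polynomial. An element $\xi\in\mathbb Z[\omega_{15}]$ is good if $\xi=uG(\omega_{15})$ with $u$ a unit of $\mathbb Z[\omega_{15}]$ and $G(x)=(x^5-1)\pm x^j\Phi_3(x)+(x-1)\Phi_3(x)\Phi_5(x)g(x)$ for some $0\le j<15$, sign and $g\in\mathbb Z[x]$. An integer $k$ coprime to 15 is 15-norm good if $k$ is the norm (from $\mathbb Q(\omega_{15})$ to $\mathbb Q$) of a good $\xi\in\mathbb Z[\omega_{15}]$. *)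

theory Defs
  imports Complex_Main
    "HOL-Computational_Algebra.Polynomial"
    "HOL-Computational_Algebra.Primes"
    "HOL-Library.FuncSet"
    "HOL-Number_Theory.Cong"
begin

definition omega :: "nat \<Rightarrow> complex" where
  "omega d = exp (2 * of_real pi * \<i> / of_nat d)"

definition eval_int_poly :: "int poly \<Rightarrow> complex \<Rightarrow> complex" where
  "eval_int_poly F z = poly (map_poly of_int F) z"

definition M_prod :: "nat \<Rightarrow> int poly \<Rightarrow> complex" where
  "M_prod n F = (\<Prod>j = 1..n. eval_int_poly F (omega n ^ j))"

definition N_prod :: "nat \<Rightarrow> int poly \<Rightarrow> complex" where
  "N_prod d F = (\<Prod>j | 1 \<le> j \<and> j \<le> d \<and> gcd j d = 1. eval_int_poly F (omega d ^ j))"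

definition cyclotomic_poly :: "nat \<Rightarrow> complex poly" where
  "cyclotomic_poly d = (\<Prod>j | 1 \<le> j \<and> j \<le> d \<and> gcd j d = 1. [:- (omega d ^ j), 1:])"

definition int_adjoin :: "complex \<Rightarrow> complex set" where
  "int_adjoin a = {eval_int_poly H a | H. True}"

definition unit_of_subring :: "complex set \<Rightarrow> complex \<Rightarrow> bool" where
  "unit_of_subring R u \<longleftrightarrow> u \<in> R \<and> (\<exists>v\<in>R. u * v = 1)"

definition rat_adjoin :: "complex \<Rightarrow> complex set" where
  "rat_adjoin a = {poly (map_poly of_rat p) a / poly (map_poly of_rat q) a | p q.
     poly (map_poly of_rat q) a \<noteq> 0}"

text \<open>
  The field embeddings of a subfield \<open>K\<close> of the complex numbers into the complex numbers.
  They are taken extensional on \<open>K\<close>, so that each embedding of \<open>K\<close> is represented by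
  exactly one function and a number field has only finitely many of them.
\<close>

definition complex_embeddings :: "complex set \<Rightarrow> (complex \<Rightarrow> complex) set" where
  "complex_embeddings K = {\<sigma> \<in> extensional K.
     \<sigma> 1 = 1 \<and>
     (\<forall>x\<in>K. \<forall>y\<in>K. \<sigma> (x + y) = \<sigma> x + \<sigma> y) \<and>
     (\<forall>x\<in>K. \<forall>y\<in>K. \<sigma> (x * y) = \<sigma> x * \<sigma> y)}"

text \<open>
  The norm from a number field \<open>K\<close> to the rationals: the product of all conjugates.
\<close>

definition field_norm :: "complex set \<Rightarrow> complex \<Rightarrow> complex" where
  "field_norm K x = (\<Prod>\<sigma>\<in>complex_embeddings K. \<sigma> x)"

definition good_poly :: "nat \<Rightarrow> int \<Rightarrow> int poly \<Rightarrow> complex poly" where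
  "good_poly j s g =
     (monom 1 5 - 1)
     + of_int s * monom 1 j * cyclotomic_poly 3
     + (monom 1 1 - 1) * cyclotomic_poly 3 * cyclotomic_poly 5 * map_poly of_int g"

definition good :: "complex \<Rightarrow> bool" where
  "good \<xi> \<longleftrightarrow> \<xi> \<in> int_adjoin (omega 15) \<and>
     (\<exists>u j s g. unit_of_subring (int_adjoin (omega 15)) u \<and> j < 15 \<and> s \<in> {1, - 1} \<and>
        \<xi> = u * poly (good_poly j s g) (omega 15))"

definition norm_good_15 :: "int \<Rightarrow> bool" where
  "norm_good_15 k \<longleftrightarrow> coprime k 15 \<and>
     (\<exists>\<xi>. good \<xi> \<and> of_int k = field_norm (rat_adjoin (omega 15)) \<xi>)"

end

theory Submission
  imports Defs "HOL-Number_Theory.Number_Theory"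
begin

text \<open>
  Write \<open>\<omega> = \<omega>\<^sub>1\<^sub>5\<close> and \<open>R = \<int>[\<omega>]\<close>. The elements \<open>\<Phi>\<^sub>5(\<omega>)\<close> and \<open>\<Phi>\<^sub>3(\<omega>)\<close> generate the primes of \<open>R\<close>
  above 3 and 5, with residue fields of order 81 and 25, and \<open>\<omega> - 1\<close> is a unit; so \<open>F(\<omega>)\<close> is good
  as soon as a unit multiple of it is congruent to \<open>\<plusminus>\<omega>\<^sup>j \<Phi>\<^sub>3(\<omega>)\<close> and to \<open>\<omega>\<^sup>5 - 1\<close> modulo these primes.
  The units \<open>\<plusminus>\<omega>\<^sup>i\<close>, the golden ratio \<open>1 + \<omega>\<^sup>3 + \<omega>\<^sup>1\<^sup>2\<close> and \<open>(1 - \<omega>)(1 - \<omega>\<^sup>2)\<close> suffice to reach these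
  residues whenever \<open>N\<^sub>5(F) \<equiv> 1 mod 3\<close> and \<open>N\<^sub>3(F) \<equiv> \<plusminus>2 mod 5\<close>; the factor \<open>1 - \<omega>\<close> reduces the case
  \<open>N\<^sub>5(F) \<equiv> -1 mod 3\<close>, \<open>N\<^sub>3(F) \<equiv> \<plusminus>1 mod 5\<close> to this one.

  From \<open>N\<^sub>1\<^sub>5 \<equiv> N\<^sub>5\<^sup>2\<close>, \<open>N\<^sub>3 \<equiv> F(1)\<^sup>2\<close> modulo 3 and \<open>N\<^sub>1\<^sub>5 \<equiv> N\<^sub>3\<^sup>4\<close>, \<open>N\<^sub>5 \<equiv> F(1)\<^sup>4\<close> modulo 5, the shape of
  \<open>M\<^sub>1\<^sub>5(F)\<close> forces one factor 3 in \<open>N\<^sub>3\<close>, or one factor 5 in \<open>N\<^sub>5\<close>. The remaining cofactors are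
  positive, and apart from the ramified primes only primes congruent to 1 modulo 3 (for \<open>N\<^sub>3\<close>) or modulo 5
  (for \<open>N\<^sub>5\<close>) occur in them to an odd power. If the primes 7, 13 modulo 15, respectively 11
  modulo 15, are absent, the cofactors are therefore \<open>\<plusminus>1\<close> modulo 5, respectively 1 modulo 3.
\<close>

subsection \<open>Primes of odd multiplicity in binary quadratic forms\<close>

text \<open>The order of \<open>x\<close> modulo \<open>p\<close> divides the prime \<open>q\<close>
  and is not 1, so it equals \<open>q\<close>; Fermat's theorem then makes \<open>q\<close> divide
  \<open>p - 1\<close>.\<close>

lemma prime_cong_1_if_root_of_unity:
  fixes p q :: nat and x :: int
  assumes "prime p" "prime q" "[x ^ q = 1] (mod int p)" "\<not> [x = 1] (mod int p)"
  shows "[p = 1] (mod q)"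
proof -
  define a where "a = nat (x mod int p)"
  have p0: "p > 0" using \<open>prime p\<close> prime_gt_0_nat by blast
  have a: "int a = x mod int p" using p0 by (simp add: a_def)
  have ax: "[int a = x] (mod int p)" by (simp add: a cong_def)
  have 1: "[a ^ q = 1] (mod p)"
  proof -
    have "[int a ^ q = 1] (mod int p)"
      using ax assms(3) cong_pow cong_trans by blast
    thus ?thesis by (metis cong_int_iff of_nat_1 of_nat_power)
  qed
  have 2: "\<not> [a = 1] (mod p)"
    using assms(4) ax cong_int_iff[of a 1 p] by (metis cong_sym cong_trans of_nat_1)
  have "ord p a dvd q" using 1 ord_divides by blast
  moreover have "ord p a \<noteq> 1" using 2 ord_eq_Suc_0_iff by simp
  ultimately have o: "ord p a = q" using \<open>prime q\<close> by (auto simp: prime_nat_iff)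
  have "\<not> p dvd a"
  proof
    assume "p dvd a"
    hence "p dvd a ^ q" using \<open>prime q\<close> by (simp add: dvd_power_same prime_gt_0_nat dvd_trans[OF _ dvd_power])
    hence "p dvd 1" using 1 by (meson cong_dvd_iff)
    thus False using \<open>prime p\<close> by simp
  qed
  hence "[a ^ (p - 1) = 1] (mod p)" using fermat_theorem assms(1) by blast
  hence "q dvd p - 1" using o ord_divides by blast
  thus ?thesis using p0 by (metis Suc_leI One_nat_def cong_altdef_nat)
qed

text \<open>Infinite descent: if \<open>p\<close> divides a value then it divides \<open>B\<close>,
  since otherwise \<open>A / B\<close> would yield a root modulo \<open>p\<close>, and hence also
  \<open>A\<close>; a factor \<open>p ^ 2\<close> splits off and a smaller pair remains.\<close>

lemma even_multiplicity_anisotropic: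
  fixes p t s A B :: int
  assumes p: "prime p" and nr: "\<And>r. \<not> p dvd r\<^sup>2 + t * r + s"
    and "A\<^sup>2 + t * A * B + s * B\<^sup>2 \<noteq> 0"
  shows "even (multiplicity p (A\<^sup>2 + t * A * B + s * B\<^sup>2))"
  using assms(3)
proof (induction "nat (\<bar>A\<bar> + \<bar>B\<bar>)" arbitrary: A B rule: less_induct)
  case less
  let ?Q = "\<lambda>A B. A\<^sup>2 + t * A * B + s * B\<^sup>2"
  show ?case
  proof (cases "p dvd ?Q A B")
    case False
    thus ?thesis by (simp add: not_dvd_imp_multiplicity_0)
  next
    case True
    have B: "p dvd B"
    proof (rule ccontr)
      assume "\<not> p dvd B"
      hence "coprime B p" using p by (metis coprime_commute prime_imp_coprime)
      then obtain i where i: "[B * i = 1] (mod p)" using cong_solve_coprime_int by blast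
      have "p dvd ?Q A B * i\<^sup>2" using True by simp
      moreover have "[?Q A B * i\<^sup>2 = (A * i)\<^sup>2 + t * (A * i) * 1 + s * 1\<^sup>2] (mod p)"
      proof -
        have "?Q A B * i\<^sup>2 = (A * i)\<^sup>2 + t * (A * i) * (B * i) + s * (B * i)\<^sup>2"
          by (simp add: algebra_simps power2_eq_square)
        also have "[\<dots> = (A * i)\<^sup>2 + t * (A * i) * 1 + s * 1\<^sup>2] (mod p)"
          by (intro cong_add cong_mult cong_pow i cong_refl)
        finally show ?thesis .
      qed
      ultimately have "p dvd (A * i)\<^sup>2 + t * (A * i) + s"
        by (simp add: cong_dvd_iff)
      thus False using nr by blast
    qed
    have "p dvd A\<^sup>2"
    proof -
      have "p dvd t * A * B + s * B\<^sup>2" using B by (simp add: power2_eq_square)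
      thus ?thesis using True by (simp add: add.assoc dvd_add_left_iff)
    qed
    hence A: "p dvd A" using p prime_dvd_power by blast
    obtain a b where ab: "A = p * a" "B = p * b" using A B by (auto elim!: dvdE)
    have Q: "?Q A B = p\<^sup>2 * ?Q a b" unfolding ab by (simp add: algebra_simps power2_eq_square)
    have p2: "p \<ge> 2" using p prime_ge_2_int by blast
    have nz: "?Q a b \<noteq> 0" using less.prems Q by auto
    have "a \<noteq> 0 \<or> b \<noteq> 0" using nz by auto
    hence pos: "\<bar>a\<bar> + \<bar>b\<bar> > 0" by linarith
    have "\<bar>A\<bar> + \<bar>B\<bar> = p * (\<bar>a\<bar> + \<bar>b\<bar>)"
      using p2 by (simp add: ab abs_mult algebra_simps)
    also have "\<dots> \<ge> 2 * (\<bar>a\<bar> + \<bar>b\<bar>)" using p2 pos by (intro mult_right_mono) auto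
    finally have "2 * (\<bar>a\<bar> + \<bar>b\<bar>) \<le> \<bar>A\<bar> + \<bar>B\<bar>" .
    moreover have "x < y" if "2 * x \<le> y" "0 < x" for x y :: int using that by linarith
    ultimately have "\<bar>a\<bar> + \<bar>b\<bar> < \<bar>A\<bar> + \<bar>B\<bar>" using pos by blast
    hence "nat (\<bar>a\<bar> + \<bar>b\<bar>) < nat (\<bar>A\<bar> + \<bar>B\<bar>)" using pos by (simp add: nat_less_eq_zless)
    from less.hyps[OF this nz] have "even (multiplicity p (?Q a b))" .
    moreover have "multiplicity p (?Q A B) = 2 + multiplicity p (?Q a b)"
      unfolding Q using p nz prime_elem_multiplicity_mult_distrib[of p "p\<^sup>2" "?Q a b"]
        multiplicity_same_power[of p 2] by auto
    ultimately show ?thesis by simp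
  qed
qed

text \<open>This is the norm form of the Eisenstein integers. Odd multiplicity forces a root
  \<open>r\<close> of \<open>r ^ 2 - r + 1\<close> modulo \<open>p\<close>, and \<open>- r\<close>
  is then a nontrivial cube root of unity.\<close>

lemma odd_multiplicity_norm3:
  fixes p :: nat and a b :: int
  assumes "prime p" "p \<noteq> 3" "odd (multiplicity (int p) (a\<^sup>2 - a * b + b\<^sup>2))"
  shows "[p = 1] (mod 3)"
proof -
  have nz: "a\<^sup>2 - a * b + b\<^sup>2 \<noteq> 0" using assms(3) by auto
  have "\<exists>r. int p dvd r\<^sup>2 + (-1) * r + 1"
    using even_multiplicity_anisotropic[of "int p" "-1" 1 a b] assms nz
    by (auto simp: algebra_simps)
  then obtain r where r: "int p dvd r\<^sup>2 - r + 1" by auto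
  have "(- r) ^ 3 - 1 = (r\<^sup>2 - r + 1) * (- r - 1)"
    by (simp add: algebra_simps power2_eq_square power3_eq_cube)
  hence 1: "[(- r) ^ 3 = 1] (mod int p)"
    using r by (simp add: cong_iff_dvd_diff)
  have 2: "\<not> [- r = 1] (mod int p)"
  proof
    assume "[- r = 1] (mod int p)"
    hence "int p dvd - r - 1" by (simp add: cong_iff_dvd_diff)
    \<comment> \<open>Division by \<open>- r - 1\<close> leaves the value of the third cyclotomic
      polynomial at 1, which is 3.\<close>
    hence "int p dvd (r\<^sup>2 - r + 1) - (- r - 1) * (- r + 2)" using r by (intro dvd_diff) auto
    also have "(r\<^sup>2 - r + 1) - (- r - 1) * (- r + 2) = 3"
      by (simp add: algebra_simps power2_eq_square)
    finally have "p dvd 3" by presburger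
    thus False using assms(1,2) by (simp add: primes_dvd_imp_eq)
  qed
  show ?thesis using prime_cong_1_if_root_of_unity[OF assms(1) _ 1 2] by simp
qed

text \<open>Hensel lifting: \<open>(2 * t + 1) ^ 2 = 4 * (t ^ 2 + t - 1) + 5\<close>, so at a root
  the derivative is invertible modulo \<open>p\<close>, as \<open>p\<close> is not 5.\<close>

lemma golden_root_lift:
  fixes p t :: int
  assumes p: "prime p" "p \<noteq> 5" and t: "p dvd t\<^sup>2 + t - 1"
  shows "\<exists>t. p ^ Suc k dvd t\<^sup>2 + t - 1"
proof (induction k)
  case 0
  thus ?case using t by auto
next
  case (Suc k)
  then obtain t where t: "p ^ Suc k dvd t\<^sup>2 + t - 1" by blast
  then obtain e where e: "t\<^sup>2 + t - 1 = p ^ Suc k * e" by (elim dvdE)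
  have "coprime (2 * t + 1) p"
  proof (rule ccontr)
    assume "\<not> coprime (2 * t + 1) p"
    hence "p dvd 2 * t + 1" using p by (metis coprime_commute prime_imp_coprime)
    moreover have "p dvd t\<^sup>2 + t - 1" using e by simp
    ultimately have "p dvd (2 * t + 1) * (2 * t + 1) - 4 * (t\<^sup>2 + t - 1)"
      by (meson dvd_diff dvd_mult dvd_mult2)
    also have "(2 * t + 1) * (2 * t + 1) - 4 * (t\<^sup>2 + t - 1) = 5"
      by (simp add: algebra_simps power2_eq_square)
    finally show False using p by (simp add: primes_dvd_imp_eq)
  qed
  then obtain i where i: "[(2 * t + 1) * i = 1] (mod p)" using cong_solve_coprime_int by blast
  \<comment> \<open>Newton correction: \<open>h\<close> solves the linearised congruence modulo
    \<open>p\<close>.\<close>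
  define h where "h = - e * i"
  have "[e + h * (2 * t + 1) = e - e * 1] (mod p)"
  proof -
    have "e + h * (2 * t + 1) = e - e * ((2 * t + 1) * i)" by (simp add: h_def algebra_simps)
    also have "[\<dots> = e - e * 1] (mod p)" by (intro cong_diff cong_mult i cong_refl)
    finally show ?thesis .
  qed
  hence "p dvd e + h * (2 * t + 1)" by (simp add: cong_0_iff)
  then obtain f where f: "e + h * (2 * t + 1) = p * f" by (elim dvdE)
  have "(t + p ^ Suc k * h)\<^sup>2 + (t + p ^ Suc k * h) - 1
      = p ^ Suc k * (e + h * (2 * t + 1)) + p ^ Suc k * p ^ Suc k * h\<^sup>2"
  proof -
    have "(t + p ^ Suc k * h)\<^sup>2 + (t + p ^ Suc k * h) - 1
        = (t\<^sup>2 + t - 1) + p ^ Suc k * (h * (2 * t + 1)) + p ^ Suc k * p ^ Suc k * h\<^sup>2"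
      by (simp add: algebra_simps power2_eq_square)
    thus ?thesis unfolding e by (simp add: algebra_simps)
  qed
  also have "\<dots> = p ^ Suc (Suc k) * (f + p ^ k * h\<^sup>2)"
    unfolding f by (simp add: algebra_simps)
  finally show ?case by (metis dvd_triv_left)
qed

text \<open>Norm of \<open>c + d * t\<close> for \<open>t ^ 2 + t = 1\<close>; the conjugate of
  \<open>t\<close> is \<open>- 1 - t\<close>.\<close>

definition golden_norm :: "int \<Rightarrow> int \<Rightarrow> int" where
  "golden_norm c d = c\<^sup>2 - c * d - d\<^sup>2"

text \<open>The norm from \<open>\<rat>(\<omega>\<^sub>5)\<close> of the element with coordinates \<open>a0, a1, a2, a3\<close>: its relative norm to
  the real subfield is \<open>c + d \<tau>\<close> with \<open>\<tau> = \<omega>\<^sub>5 + \<omega>\<^sub>5\<^sup>-\<^sup>1\<close>, \<open>\<tau>\<^sup>2 + \<tau> = 1\<close>.\<close>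

definition real_part5 :: "int \<Rightarrow> int \<Rightarrow> int \<Rightarrow> int \<Rightarrow> int" where
  "real_part5 a0 a1 a2 a3 = a0\<^sup>2 + a1\<^sup>2 + a2\<^sup>2 + a3\<^sup>2 - (a0 * a2 + a1 * a3 + a0 * a3)"

definition tau_part5 :: "int \<Rightarrow> int \<Rightarrow> int \<Rightarrow> int \<Rightarrow> int" where
  "tau_part5 a0 a1 a2 a3 = (a0 * a1 + a1 * a2 + a2 * a3) - (a0 * a2 + a1 * a3 + a0 * a3)"

definition norm5 :: "int \<Rightarrow> int \<Rightarrow> int \<Rightarrow> int \<Rightarrow> int" where
  "norm5 a0 a1 a2 a3 = golden_norm (real_part5 a0 a1 a2 a3) (tau_part5 a0 a1 a2 a3)"

text \<open>Modulo \<open>p\<close> the quadratic divides the fifth cyclotomic polynomial evaluated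
  at \<open>- r\<close>, so a root would give an element of order 5.\<close>

lemma no_root_mod_prime_not_cong_1_mod_5:
  fixes p :: nat and t r :: int
  assumes "prime p" "p \<noteq> 5" "\<not> [p = 1] (mod 5)" "int p dvd t\<^sup>2 + t - 1"
  shows "\<not> int p dvd r\<^sup>2 + t * r + 1"
proof
  assume r: "int p dvd r\<^sup>2 + t * r + 1"
  have "int p dvd (r\<^sup>2 + t * r + 1) * (r\<^sup>2 - (1 + t) * r + 1) + (t\<^sup>2 + t - 1) * r\<^sup>2"
    using r assms(4) by (meson dvd_add dvd_mult2)
  also have "(r\<^sup>2 + t * r + 1) * (r\<^sup>2 - (1 + t) * r + 1) + (t\<^sup>2 + t - 1) * r\<^sup>2
     = r ^ 4 - r ^ 3 + r\<^sup>2 - r + 1"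
    by (simp add: algebra_simps power2_eq_square power3_eq_cube power4_eq_xxxx)
  finally have r4: "int p dvd r ^ 4 - r ^ 3 + r\<^sup>2 - r + 1" .
  have "(- r) ^ 5 - 1 = (r ^ 4 - r ^ 3 + r\<^sup>2 - r + 1) * (- r - 1)"
    by (simp add: algebra_simps power2_eq_square power3_eq_cube power4_eq_xxxx eval_nat_numeral)
  hence 1: "[(- r) ^ 5 = 1] (mod int p)"
    using r4 by (simp only: cong_iff_dvd_diff) simp
  have 2: "\<not> [- r = 1] (mod int p)"
  proof
    assume "[- r = 1] (mod int p)"
    hence "int p dvd - r - 1" by (simp add: cong_iff_dvd_diff)
    hence "int p dvd (r ^ 4 - r ^ 3 + r\<^sup>2 - r + 1) - (- r - 1) * (- (r ^ 3) + 2 * r\<^sup>2 - 3 * r + 4)"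
      using r4 by (intro dvd_diff) auto
    also have "(r ^ 4 - r ^ 3 + r\<^sup>2 - r + 1) - (- r - 1) * (- (r ^ 3) + 2 * r\<^sup>2 - 3 * r + 4) = 5"
      by (simp add: algebra_simps power2_eq_square power3_eq_cube power4_eq_xxxx)
    finally have "p dvd 5" by presburger
    thus False using assms(1,2) by (simp add: primes_dvd_imp_eq)
  qed
  show False using prime_cong_1_if_root_of_unity[OF assms(1) _ 1 2] assms(3) by simp
qed

text \<open>If the golden polynomial has no root modulo \<open>p\<close>, the outer form \<open>c\<^sup>2 - c d - d\<^sup>2\<close> is anisotropic.
  Otherwise a root \<open>t\<close> modulo a high power of \<open>p\<close> splits the norm into a product of two values
  of the anisotropic forms \<open>A\<^sup>2 + t A B + B\<^sup>2\<close>.\<close>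

lemma odd_multiplicity_norm5:
  fixes p :: nat and a0 a1 a2 a3 :: int
  assumes p: "prime p" "p \<noteq> 5" and odd: "odd (multiplicity (int p) (norm5 a0 a1 a2 a3))"
  shows "[p = 1] (mod 5)"
proof (rule ccontr)
  assume np: "\<not> [p = 1] (mod 5)"
  define P where "P = int p"
  have P: "prime P" "P \<noteq> 5" using p by (auto simp: P_def)
  define c where "c = real_part5 a0 a1 a2 a3"
  define d where "d = tau_part5 a0 a1 a2 a3"
  define N where "N = norm5 a0 a1 a2 a3"
  have N: "N = c\<^sup>2 - c * d - d\<^sup>2" by (simp add: N_def norm5_def golden_norm_def c_def d_def)
  have nz: "N \<noteq> 0" using odd by (auto simp: N_def)
  show False
  proof (cases "\<exists>t. P dvd t\<^sup>2 + t - 1")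
    case False
    have "\<not> P dvd r\<^sup>2 + (-1) * r + (-1)" for r
    proof -
      have "r\<^sup>2 + (-1) * r + (-1) = (- r)\<^sup>2 + (- r) - 1" by simp
      thus ?thesis using False by metis
    qed
    from even_multiplicity_anisotropic[OF P(1) this, of c d] nz
    have "even (multiplicity P N)" by (simp add: N)
    thus False using odd by (simp add: N_def P_def)
  next
    case True
    define K where "K = multiplicity P N"
    \<comment> \<open>The precision \<open>Suc K\<close> exceeds the multiplicity of
      \<open>N\<close>, so passing from \<open>N\<close> to a congruent number preserves that
      multiplicity exactly.\<close>
    obtain t where t: "P ^ Suc K dvd t\<^sup>2 + t - 1" using True golden_root_lift[OF P] by blast
    have tP: "P dvd t\<^sup>2 + t - 1" using t by (meson dvd_power dvd_trans zero_less_Suc)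
    have nr: "\<not> P dvd r\<^sup>2 + t * r + 1" for r
      using no_root_mod_prime_not_cong_1_mod_5[OF p np] tP by (simp add: P_def)
    define t' where "t' = - 1 - t"
    have t'e: "t'\<^sup>2 + t' - 1 = t\<^sup>2 + t - 1" by (simp add: t'_def power2_eq_square algebra_simps)
    have nr': "\<not> P dvd r\<^sup>2 + t' * r + 1" for r
      using no_root_mod_prime_not_cong_1_mod_5[OF p np] tP t'e by (simp add: P_def)
    \<comment> \<open>Reducing \<open>a0 + a1 * x + a2 * x ^ 2 + a3 * x ^ 3\<close> modulo
      \<open>x ^ 2 - t * x + 1\<close>, with \<open>t ^ 2 = 1 - t\<close>, leaves
      \<open>A t + B t * x\<close>; \<open>Q t\<close> is the norm of this remainder.\<close>
    define A where "A = (\<lambda>t. a0 - a2 - t * a3)"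
    define B where "B = (\<lambda>t. a1 + t * a2 - t * a3)"
    define Q where "Q = (\<lambda>t. (A t)\<^sup>2 + t * A t * B t + (B t)\<^sup>2)"
    have Q: "\<exists>h. Q t = c + d * t + (t\<^sup>2 + t - 1) * h" for t
    proof
      show "Q t = c + d * t + (t\<^sup>2 + t - 1) *
          (a3\<^sup>2 + (a0 - a2) * (a2 - a3) - a3 * a1 + (a2 - a3)\<^sup>2 - (t - 1) * a3 * (a2 - a3))"
        by (simp add: Q_def A_def B_def c_def d_def real_part5_def tau_part5_def
            algebra_simps power2_eq_square)
    qed
    obtain h h' where h: "Q t = c + d * t + (t\<^sup>2 + t - 1) * h"
      "Q t' = c + d * t' + (t\<^sup>2 + t - 1) * h'"
      using Q[of t] Q[of t'] t'e by auto
    have "(c + d * t) * (c + d * t') = N - (t\<^sup>2 + t - 1) * d\<^sup>2"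
      unfolding N t'_def by (simp add: algebra_simps power2_eq_square)
    hence "Q t * Q t' = N + (t\<^sup>2 + t - 1) * (- d\<^sup>2 + h * (c + d * t') + h' * (c + d * t)
        + (t\<^sup>2 + t - 1) * h * h')"
      unfolding h by (simp add: algebra_simps)
    then obtain g where g: "Q t * Q t' = N + P ^ Suc K * g"
      using t by (metis dvdE mult.assoc)
    have PK: "P ^ K dvd N" "\<not> P ^ Suc K dvd N"
      using nz P(1) by (auto simp: K_def multiplicity_dvd intro!: not_dvd_imp_multiplicity_0)
         (metis multiplicity_geI not_less_eq_eq order_refl not_prime_unit power_Suc)
    have 1: "P ^ K dvd Q t * Q t'" unfolding g using PK(1) by simp
    have 2: "\<not> P ^ Suc K dvd Q t * Q t'" unfolding g using PK(2)
      by (metis dvd_add_left_iff dvd_triv_left)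
    have nzQ: "Q t * Q t' \<noteq> 0" using 2 by auto
    have "multiplicity P (Q t * Q t') = K" using 1 2 by (intro multiplicity_eqI) auto
    moreover have "multiplicity P (Q t * Q t') = multiplicity P (Q t) + multiplicity P (Q t')"
      using P nzQ by (intro prime_elem_multiplicity_mult_distrib) auto
    moreover have "even (multiplicity P (Q t))"
      using even_multiplicity_anisotropic[OF P(1) nr, of "A t" "B t"] nzQ by (auto simp: Q_def)
    moreover have "even (multiplicity P (Q t'))"
      using even_multiplicity_anisotropic[OF P(1) nr', of "A t'" "B t'"] nzQ by (auto simp: Q_def)
    ultimately have "even K" by (metis even_add)
    thus False using odd by (simp add: K_def N_def P_def)
  qed
qed

text \<open>Primes of even multiplicity contribute squares, which satisfy \<open>S\<close>; if all
  primes of odd multiplicity satisfied \<open>S\<close>, so would their product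
  \<open>n\<close>.\<close>

lemma odd_multiplicity_prime_outside_subgroup:
  fixes n :: nat and S :: "nat \<Rightarrow> bool"
  assumes "n > 0" "\<not> S n" "S 1" "\<And>a b. S a \<Longrightarrow> S b \<Longrightarrow> S (a * b)" "\<And>a. S (a * a)"
  shows "\<exists>p. prime p \<and> odd (multiplicity p n) \<and> \<not> S p"
proof (rule ccontr)
  assume c: "\<not> ?thesis"
  have pow: "S (a ^ k)" if "S a" for a k
    by (induction k) (use that assms(3,4) in auto)
  have "S (p ^ multiplicity p n)" if "p \<in> prime_factors n" for p
  proof (cases "even (multiplicity p n)")
    case True
    then obtain k where "multiplicity p n = 2 * k" by blast
    hence "p ^ multiplicity p n = (p * p) ^ k" by (simp add: power_mult power2_eq_square)
    thus ?thesis using pow[OF assms(5)] by simp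
  next
    case False
    thus ?thesis using c that pow by auto
  qed
  moreover have "S (\<Prod>p\<in>X. f p)" if "finite X" "\<And>p. p \<in> X \<Longrightarrow> S (f p)" for X :: "nat set" and f
    using that by (induction X rule: finite_induct) (use assms(3,4) in auto)
  ultimately have "S (\<Prod>p\<in>prime_factors n. p ^ multiplicity p n)" by auto
  thus False using assms(1,2) by (metis prime_factorization_nat)
qed

subsection \<open>Evaluation of integer polynomials\<close>

lemma eval_int_poly_add: "eval_int_poly (P + Q) z = eval_int_poly P z + eval_int_poly Q z"
proof -
  have "map_poly of_int (P + Q) = map_poly of_int P + (map_poly of_int Q :: complex poly)"
    by (rule poly_eqI) (simp add: coeff_map_poly)
  thus ?thesis by (simp add: eval_int_poly_def)
qed

lemma eval_int_poly_0 [simp]: "eval_int_poly 0 z = 0"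
  by (simp add: eval_int_poly_def)

lemma eval_int_poly_pCons [simp]:
  "eval_int_poly (pCons c P) z = of_int c + z * eval_int_poly P z"
  by (simp add: eval_int_poly_def map_poly_pCons)

lemma eval_int_poly_smult: "eval_int_poly (Polynomial.smult c P) z = of_int c * eval_int_poly P z"
  by (induction P) (simp_all add: algebra_simps)

lemma eval_int_poly_mult: "eval_int_poly (P * Q) z = eval_int_poly P z * eval_int_poly Q z"
  by (induction P) (simp_all add: eval_int_poly_add eval_int_poly_smult algebra_simps)

lemma eval_int_poly_uminus: "eval_int_poly (- P) z = - eval_int_poly P z"
  using eval_int_poly_smult[of "- 1" P z] by simp

lemma eval_int_poly_diff: "eval_int_poly (P - Q) z = eval_int_poly P z - eval_int_poly Q z"
  by (metis diff_conv_add_uminus eval_int_poly_add eval_int_poly_uminus)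

lemma eval_int_poly_1 [simp]: "eval_int_poly 1 z = 1"
  by (simp add: eval_int_poly_def)

lemma eval_int_poly_power: "eval_int_poly (P ^ n) z = eval_int_poly P z ^ n"
  by (induction n) (simp_all add: eval_int_poly_mult)

lemma eval_int_poly_monom: "eval_int_poly (Polynomial.monom c n) z = of_int c * z ^ n"
  by (simp add: eval_int_poly_def map_poly_monom poly_monom)

lemma eval_int_poly_pcompose: "eval_int_poly (pcompose P Q) z = eval_int_poly P (eval_int_poly Q z)"
  by (induction P) (simp_all add: pcompose_pCons eval_int_poly_add eval_int_poly_mult)

lemma eval_int_poly_at_int: "eval_int_poly P (of_int k) = of_int (poly P k)"
  by (induction P) simp_all

lemma cnj_eval_int_poly: "cnj (eval_int_poly P z) = eval_int_poly P (cnj z)"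
  by (induction P) simp_all

lemmas eval_int_poly_hom = eval_int_poly_add eval_int_poly_smult eval_int_poly_mult
  eval_int_poly_uminus eval_int_poly_diff eval_int_poly_power eval_int_poly_monom

subsection \<open>Remainders modulo the third and the fifth cyclotomic polynomial\<close>

abbreviation Phi3 :: "int poly" where "Phi3 \<equiv> [:1, 1, 1:]"
abbreviation Phi5 :: "int poly" where "Phi5 \<equiv> [:1, 1, 1, 1, 1:]"

lemma remainder_Phi3: "\<exists>Q b0 b1. P = Phi3 * Q + [:b0, b1:]"
proof (induction P)
  case 0
  show ?case by (rule exI[of _ 0]) auto
next
  case (pCons c P)
  then obtain Q b0 b1 where "P = Phi3 * Q + [:b0, b1:]" by blast
  hence "pCons c P = Phi3 * (pCons b1 Q) + [:c - b1, b0 - b1:]" by simp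
  thus ?case by blast
qed

lemma remainder_Phi5: "\<exists>Q a0 a1 a2 a3. P = Phi5 * Q + [:a0, a1, a2, a3:]"
proof (induction P)
  case 0
  show ?case by (rule exI[of _ 0]) auto
next
  case (pCons c P)
  then obtain Q a0 a1 a2 a3 where "P = Phi5 * Q + [:a0, a1, a2, a3:]" by blast
  hence "pCons c P = Phi5 * (pCons a3 Q) + [:c - a3, a0 - a3, a1 - a3, a2 - a3:]" by simp
  thus ?case by blast
qed

text \<open>Given by the cyclotomic equation instead of a particular root, so that results apply to
  all conjugates at once.\<close>

definition prim3 :: "complex \<Rightarrow> bool" where
  "prim3 u \<longleftrightarrow> u\<^sup>2 + u + 1 = 0"

definition prim5 :: "complex \<Rightarrow> bool" where
  "prim5 z \<longleftrightarrow> z ^ 4 + z ^ 3 + z\<^sup>2 + z + 1 = 0"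

lemma prim3_cube: assumes "prim3 u" shows "u ^ 3 = 1"
proof -
  have "u ^ 3 - 1 = (u\<^sup>2 + u + 1) * (u - 1)"
    by (simp add: algebra_simps power2_eq_square power3_eq_cube)
  thus ?thesis using assms by (simp add: prim3_def)
qed

lemma prim5_pow5: assumes "prim5 z" shows "z ^ 5 = 1"
proof -
  have "z ^ 5 - 1 = (z ^ 4 + z ^ 3 + z\<^sup>2 + z + 1) * (z - 1)"
    by (simp add: algebra_simps eval_nat_numeral)
  thus ?thesis using assms by (simp add: prim5_def)
qed

lemma prim5_norm: assumes "prim5 z" shows "cmod z = 1"
proof -
  have "cmod z ^ 5 = 1" using prim5_pow5[OF assms] by (metis norm_one norm_power)
  thus ?thesis using power_eq_imp_eq_base[of "cmod z" 5 1] by simp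
qed

lemma prim5_cnj: assumes "prim5 z" shows "cnj z = z ^ 4"
proof -
  have "z * cnj z = 1" using prim5_norm[OF assms] by (simp add: complex_norm_square[symmetric])
  hence "z ^ 4 * (z * cnj z) = z ^ 4" by simp
  moreover have "z ^ 4 * (z * cnj z) = z ^ 5 * cnj z" by (simp add: eval_nat_numeral)
  ultimately show ?thesis using prim5_pow5[OF assms] by simp
qed

lemma prim3_norm: assumes "prim3 u" shows "cmod u = 1"
proof -
  have "cmod u ^ 3 = 1" using prim3_cube[OF assms] by (metis norm_one norm_power)
  thus ?thesis using power_eq_imp_eq_base[of "cmod u" 3 1] by simp
qed

lemma prim3_cnj: assumes "prim3 u" shows "cnj u = u\<^sup>2"
proof -
  have "u * cnj u = 1" using prim3_norm[OF assms] by (simp add: complex_norm_square[symmetric])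
  hence "u\<^sup>2 * (u * cnj u) = u\<^sup>2" by simp
  moreover have "u\<^sup>2 * (u * cnj u) = u ^ 3 * cnj u" by (simp add: eval_nat_numeral)
  ultimately show ?thesis using prim3_cube[OF assms] by simp
qed

lemma power_eq_power_mod:
  fixes x :: "'a :: monoid_mult"
  assumes "x ^ n = 1" shows "x ^ k = x ^ (k mod n)"
proof -
  have "x ^ k = x ^ (n * (k div n) + k mod n)" by simp
  thus ?thesis using assms by (simp only: power_add power_mult) simp
qed

lemma prim5_power: assumes "prim5 z" "k \<in> {1, 2, 3, 4}" shows "prim5 (z ^ k)"
proof -
  have z: "z ^ 5 = 1" by (rule prim5_pow5[OF assms(1)])
  have e: "z ^ 6 = z" "z ^ 8 = z ^ 3" "z ^ 9 = z ^ 4" "z ^ 12 = z\<^sup>2" "z ^ 16 = z"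
    using power_eq_power_mod[OF z, of 6] power_eq_power_mod[OF z, of 8]
      power_eq_power_mod[OF z, of 9] power_eq_power_mod[OF z, of 12]
      power_eq_power_mod[OF z, of 16] by simp_all
  have r: "z ^ 4 + z ^ 3 + z\<^sup>2 + z + 1 = 0" using assms(1) by (simp add: prim5_def)
  consider "k = 1" | "k = 2" | "k = 3" | "k = 4" using assms(2) by auto
  thus ?thesis
  proof cases
    case 1
    thus ?thesis using assms(1) by simp
  next
    case 2
    show ?thesis unfolding prim5_def 2 using r
      by (simp add: e add_ac flip: power_mult)
  next
    case 3
    show ?thesis unfolding prim5_def 3 using r
      by (simp add: e add_ac flip: power_mult)
  next
    case 4
    show ?thesis unfolding prim5_def 4 using r
      by (simp add: e add_ac flip: power_mult)
  qed
qed

section \<open>Norms at third and fifth roots of unity as integral forms\<close>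

lemma eval_remainder_Phi5:
  assumes "prim5 z"
  shows "eval_int_poly (Phi5 * Q + [:a0, a1, a2, a3:]) z
    = of_int a0 + of_int a1 * z + of_int a2 * z\<^sup>2 + of_int a3 * z ^ 3"
proof -
  have "eval_int_poly Phi5 z = 0"
    using assms by (simp add: prim5_def algebra_simps eval_nat_numeral)
  thus ?thesis unfolding eval_int_poly_add eval_int_poly_mult
    by (simp only:) (simp add: algebra_simps power2_eq_square power3_eq_cube)
qed

lemma eval_remainder_Phi3:
  assumes "prim3 u"
  shows "eval_int_poly (Phi3 * Q + [:b0, b1:]) u = of_int b0 + of_int b1 * u"
proof -
  have "eval_int_poly Phi3 u = 0"
    using assms by (simp add: prim3_def algebra_simps eval_nat_numeral)
  thus ?thesis unfolding eval_int_poly_add eval_int_poly_mult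
    by (simp only:) (simp add: algebra_simps power2_eq_square power3_eq_cube)
qed

lemma prim5_tau: assumes "prim5 z" shows "(z + z ^ 4)\<^sup>2 = 1 - (z + z ^ 4)"
proof -
  have "(z + z ^ 4)\<^sup>2 + (z + z ^ 4) - 1 = z\<^sup>2 + 2 * z ^ 5 + z ^ 5 * z ^ 3 + z + z ^ 4 - 1"
    by (simp add: power2_eq_square algebra_simps eval_nat_numeral)
  also have "\<dots> = z ^ 4 + z ^ 3 + z\<^sup>2 + z + 1"
    by (simp add: prim5_pow5[OF assms])
  also have "\<dots> = 0" using assms by (simp only: prim5_def)
  finally show ?thesis by (simp only: right_minus_eq eq_diff_eq)
qed

text \<open>As \<open>z ^ 4\<close> is the inverse of \<open>z\<close>, the product is symmetric in
  both and so becomes a polynomial in \<open>z + z ^ 4\<close>, reduced by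
  \<open>prim5_tau\<close>.\<close>

lemma relative_norm5:
  assumes z: "prim5 z" and P: "P = Phi5 * Q + [:a0, a1, a2, a3:]"
  shows "eval_int_poly P z * eval_int_poly P (z ^ 4)
    = of_int (real_part5 a0 a1 a2 a3) + of_int (tau_part5 a0 a1 a2 a3) * (z + z ^ 4)"
proof -
  define y where "y = z ^ 4"
  define t where "t = z + y"
  have y: "prim5 y" using prim5_power[OF z, of 4] by (simp add: y_def)
  have zy: "z * y = 1" using prim5_pow5[OF z] by (simp add: y_def eval_nat_numeral)
  have t2: "t\<^sup>2 = 1 - t" using prim5_tau[OF z] by (simp add: t_def y_def)
  have s2: "z\<^sup>2 + y\<^sup>2 = - 1 - t"
  proof -
    have "z\<^sup>2 + y\<^sup>2 = t\<^sup>2 - 2 * (z * y)" by (simp add: t_def power2_eq_square algebra_simps)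
    thus ?thesis by (simp add: t2 zy)
  qed
  have s3: "z ^ 3 + y ^ 3 = - 1 - t"
  proof -
    have "z ^ 3 + y ^ 3 = t * (z\<^sup>2 + y\<^sup>2) - (z * y) * t"
      by (simp add: t_def power2_eq_square power3_eq_cube algebra_simps)
    also have "\<dots> = - 2 * t - t\<^sup>2" unfolding s2 zy by (simp add: algebra_simps power2_eq_square)
    finally show ?thesis by (simp add: t2)
  qed
  have "(of_int a0 + of_int a1 * z + of_int a2 * z\<^sup>2 + of_int a3 * z ^ 3)
      * (of_int a0 + of_int a1 * y + of_int a2 * y\<^sup>2 + of_int a3 * y ^ 3)
    = of_int a0 ^ 2 + of_int a1 ^ 2 * (z * y) + of_int a2 ^ 2 * (z * y) ^ 2 + of_int a3 ^ 2 * (z * y) ^ 3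
      + (of_int a0 * of_int a1 + of_int a1 * of_int a2 * (z * y) + of_int a2 * of_int a3 * (z * y) ^ 2) * t
      + (of_int a0 * of_int a2 + of_int a1 * of_int a3 * (z * y)) * (z\<^sup>2 + y\<^sup>2)
      + of_int a0 * of_int a3 * (z ^ 3 + y ^ 3)"
    by (simp add: t_def power2_eq_square power3_eq_cube algebra_simps)
  also have "\<dots> = of_int (real_part5 a0 a1 a2 a3) + of_int (tau_part5 a0 a1 a2 a3) * t"
    unfolding zy s2 s3 by (simp add: real_part5_def tau_part5_def algebra_simps)
  finally show ?thesis
    unfolding P eval_remainder_Phi5[OF z] eval_remainder_Phi5[OF y, unfolded y_def]
    by (simp add: y_def t_def)
qed

definition eval_norm5 :: "int poly \<Rightarrow> complex \<Rightarrow> complex" where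
  "eval_norm5 P z = eval_int_poly P z * eval_int_poly P (z\<^sup>2) * eval_int_poly P (z ^ 3) * eval_int_poly P (z ^ 4)"

definition eval_norm3 :: "int poly \<Rightarrow> complex \<Rightarrow> complex" where
  "eval_norm3 P u = eval_int_poly P u * eval_int_poly P (u\<^sup>2)"

lemma golden_norm_factor:
  assumes "t\<^sup>2 = 1 - t"
  shows "(of_int c + of_int d * t) * (of_int c + of_int d * (- 1 - t)) = (of_int (golden_norm c d) :: complex)"
proof -
  have "(of_int c + of_int d * t) * (of_int c + of_int d * (- 1 - t))
      = of_int c ^ 2 - of_int c * of_int d - of_int d ^ 2 * (t + t\<^sup>2)"
    by (simp add: power2_eq_square algebra_simps)
  thus ?thesis unfolding assms by (simp add: golden_norm_def)
qed

text \<open>The factors form two inverse pairs, and the pair at \<open>z ^ 2\<close>,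
  \<open>z ^ 3\<close> carries the conjugate of \<open>z + z ^ 4\<close>. The value is therefore the
  same for every primitive \<open>z\<close>.\<close>

lemma eval_norm5_eq:
  assumes z: "prim5 z" and P: "P = Phi5 * Q + [:a0, a1, a2, a3:]"
  shows "eval_norm5 P z = of_int (norm5 a0 a1 a2 a3)"
proof -
  have z2: "prim5 (z\<^sup>2)" using prim5_power[OF z, of 2] by simp
  have e: "(z\<^sup>2) ^ 4 = z ^ 3"
    using power_eq_power_mod[OF prim5_pow5[OF z], of 8] by (simp flip: power_mult)
  have s: "z\<^sup>2 + z ^ 3 = - 1 - (z + z ^ 4)"
  proof -
    have "c + b = - 1 - (d + a)" if "a + b + c + d + 1 = 0" for a b c d :: complex
    proof -
      have "c + b = (a + b + c + d + 1) - 1 - (d + a)" by simp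
      thus ?thesis by (simp only: that) simp
    qed
    thus ?thesis using z unfolding prim5_def by blast
  qed
  have 1: "eval_int_poly P (z\<^sup>2) * eval_int_poly P (z ^ 3)
      = of_int (real_part5 a0 a1 a2 a3) + of_int (tau_part5 a0 a1 a2 a3) * (- 1 - (z + z ^ 4))"
    using relative_norm5[OF z2 P] unfolding e s .
  have "eval_norm5 P z = (eval_int_poly P z * eval_int_poly P (z ^ 4))
      * (eval_int_poly P (z\<^sup>2) * eval_int_poly P (z ^ 3))"
    unfolding eval_norm5_def by (simp only: mult_ac)
  also have "\<dots> = of_int (norm5 a0 a1 a2 a3)"
    unfolding 1 relative_norm5[OF z P] norm5_def by (rule golden_norm_factor[OF prim5_tau[OF z]])
  finally show ?thesis .
qed

lemma eval_norm3_eq: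
  assumes u: "prim3 u" and P: "P = Phi3 * Q + [:b0, b1:]"
  shows "eval_norm3 P u = of_int (b0\<^sup>2 - b0 * b1 + b1\<^sup>2)"
proof -
  have u3: "u ^ 3 = 1" by (rule prim3_cube[OF u])
  have u2: "prim3 (u\<^sup>2)"
    using u power_eq_power_mod[OF u3, of 4] by (simp add: prim3_def algebra_simps flip: power_mult)
  have "(of_int b0 + of_int b1 * u) * (of_int b0 + of_int b1 * u\<^sup>2)
      = of_int b0 ^ 2 + of_int b0 * of_int b1 * ((u\<^sup>2 + u + 1) - 1) + of_int b1 ^ 2 * u ^ 3"
    by (simp add: power2_eq_square power3_eq_cube algebra_simps)
  also have "\<dots> = of_int (b0\<^sup>2 - b0 * b1 + b1\<^sup>2)" using u u3 by (simp add: prim3_def)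
  finally show ?thesis
    unfolding eval_norm3_def P eval_remainder_Phi3[OF u] eval_remainder_Phi3[OF u2] .
qed

text \<open>Above 5 the root of unity becomes 1 and its trace \<open>t\<close> becomes 2: modulo 5,
  \<open>golden_norm c d\<close> is \<open>(c + 2 * d) ^ 2\<close>, and \<open>c + 2 * d\<close> is
  the square of the coefficient sum.\<close>

lemma norm5_cong_power4: "[norm5 a0 a1 a2 a3 = (a0 + a1 + a2 + a3) ^ 4] (mod 5)"
proof -
  define c where "c = real_part5 a0 a1 a2 a3"
  define d where "d = tau_part5 a0 a1 a2 a3"
  define S where "S = a0 * a2 + a1 * a3 + a0 * a3"
  have "c + 2 * d = (a0 + a1 + a2 + a3)\<^sup>2 - 5 * S"
    by (simp add: c_def d_def S_def real_part5_def tau_part5_def power2_eq_square algebra_simps)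
  hence "(a0 + a1 + a2 + a3)\<^sup>2 = c + 2 * d + 5 * S" by simp
  hence "(a0 + a1 + a2 + a3) ^ 4 = (c + 2 * d + 5 * S)\<^sup>2"
    using power_mult[of "a0 + a1 + a2 + a3" 2 2] by simp
  hence "norm5 a0 a1 a2 a3 - (a0 + a1 + a2 + a3) ^ 4
     = 5 * (- c * d - d\<^sup>2 - 2 * S * (c + 2 * d) - 5 * S\<^sup>2)"
    by (simp add: norm5_def golden_norm_def c_def[symmetric] d_def[symmetric] power2_eq_square algebra_simps)
  thus ?thesis by (metis cong_iff_dvd_diff dvd_triv_left)
qed

lemma norm5_cong_mod3:
  "[norm5 (a0 + 3 * e0) (a1 + 3 * e1) (a2 + 3 * e2) (a3 + 3 * e3) = norm5 a0 a1 a2 a3] (mod 3)"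
proof -
  have *: "[a + 3 * e = a] (mod 3)" for a e :: int by (simp add: cong_def)
  show ?thesis
    unfolding norm5_def golden_norm_def real_part5_def tau_part5_def
    by (intro cong_add cong_diff cong_mult cong_pow *)
qed

text \<open>The factors come in complex conjugate pairs.\<close>

lemma eval_norm5_nonneg:
  assumes z: "prim5 z" and "eval_norm5 P z = of_int n"
  shows "n \<ge> 0"
proof -
  have e: "cnj (z\<^sup>2) = z ^ 3"
    using power_eq_power_mod[OF prim5_pow5[OF z], of 8] by (simp add: prim5_cnj[OF z] flip: power_mult)
  have "eval_norm5 P z = (eval_int_poly P z * cnj (eval_int_poly P z))
      * (eval_int_poly P (z\<^sup>2) * cnj (eval_int_poly P (z\<^sup>2)))"
    by (simp only: cnj_eval_int_poly e prim5_cnj[OF z] eval_norm5_def mult_ac)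
  also have "\<dots> = of_real ((cmod (eval_int_poly P z))\<^sup>2 * (cmod (eval_int_poly P (z\<^sup>2)))\<^sup>2)"
    by (simp only: complex_norm_square[symmetric] of_real_mult)
  finally have "of_real (of_int n) = complex_of_real ((cmod (eval_int_poly P z))\<^sup>2 * (cmod (eval_int_poly P (z\<^sup>2)))\<^sup>2)"
    using assms(2) by simp
  hence "real_of_int n = (cmod (eval_int_poly P z))\<^sup>2 * (cmod (eval_int_poly P (z\<^sup>2)))\<^sup>2"
    using of_real_eq_iff by blast
  hence "real_of_int n \<ge> 0" by simp
  thus ?thesis by simp
qed

subsection \<open>Linear independence\<close>

text \<open>Irrationality of the square root of 5, by parity of the multiplicity of 5.\<close>

lemma square_eq_5_square:
  fixes a b :: int
  assumes "a\<^sup>2 = 5 * b\<^sup>2" shows "a = 0 \<and> b = 0"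
proof -
  have "b = 0"
  proof (rule ccontr)
    assume b: "b \<noteq> 0"
    hence a: "a \<noteq> 0" using assms by auto
    have p: "prime_elem (5::int)" by simp
    have "multiplicity 5 (a\<^sup>2) = 2 * multiplicity 5 a"
      using a p by (simp add: prime_elem_multiplicity_power_distrib)
    moreover have "multiplicity 5 (5 * b\<^sup>2) = Suc (2 * multiplicity 5 b)"
      using b p by (simp add: prime_elem_multiplicity_mult_distrib prime_elem_multiplicity_power_distrib)
    ultimately have "2 * multiplicity 5 a = Suc (2 * multiplicity 5 b)" using assms by simp
    thus False by presburger
  qed
  thus ?thesis using assms by simp
qed

lemma golden_norm_eq_0:
  assumes "golden_norm c d = 0" shows "c = 0 \<and> d = 0"
proof -
  have "(2 * c - d)\<^sup>2 = 5 * d\<^sup>2 + 4 * golden_norm c d"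
    by (simp add: golden_norm_def power2_eq_square algebra_simps)
  hence "(2 * c - d)\<^sup>2 = 5 * d\<^sup>2" using assms by simp
  from square_eq_5_square[OF this] show ?thesis by auto
qed

lemma golden_independent:
  assumes "t\<^sup>2 = 1 - t" "of_int c + of_int d * t = (0 :: complex)"
  shows "c = 0 \<and> d = 0"
proof (rule golden_norm_eq_0)
  have "of_int (golden_norm c d) = (0 :: complex)"
    unfolding golden_norm_factor[OF assms(1), symmetric] assms(2) by simp
  thus "golden_norm c d = 0" by simp
qed

text \<open>Stands in for irreducibility of the fifth cyclotomic polynomial. A zero at
  \<open>z\<close> kills both coordinates of the relative norm, which serve every
  \<open>z ^ k\<close>; there the relative norm is a squared absolute value.\<close>

lemma eval_0_prim5_power:
  assumes z: "prim5 z" and P: "eval_int_poly P z = 0" and k: "k \<in> {1, 2, 3, 4}"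
  shows "eval_int_poly P (z ^ k) = 0"
proof -
  obtain Q a0 a1 a2 a3 where R: "P = Phi5 * Q + [:a0, a1, a2, a3:]" using remainder_Phi5 by blast
  have "real_part5 a0 a1 a2 a3 = 0 \<and> tau_part5 a0 a1 a2 a3 = 0"
    by (rule golden_independent[OF prim5_tau[OF z]])
      (simp only: relative_norm5[OF z R, symmetric] P mult_zero_left)
  hence 0: "eval_int_poly P (z ^ k) * eval_int_poly P ((z ^ k) ^ 4) = 0"
    using relative_norm5[OF prim5_power[OF z k] R] by simp
  have "eval_int_poly P (z ^ k) * cnj (eval_int_poly P (z ^ k)) = 0"
    unfolding cnj_eval_int_poly prim5_cnj[OF prim5_power[OF z k]] by (rule 0)
  thus ?thesis by simp
qed

text \<open>If \<open>\<omega>\<^sub>3\<close> were a quotient of elements of \<open>\<int>[\<omega>\<^sub>5]\<close>, then \<open>-3\<close> would be \<open>(\<tau>\<^sup>2 - 4)\<close> times a square in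
  \<open>\<rat>(\<tau>)\<close>; taking norms, 9 would be five times a rational square.\<close>

lemma prim3_prim5_independent:
  assumes z: "prim5 z" and u: "prim3 u" and AB: "eval_int_poly A z + eval_int_poly B z * u = 0"
  shows "eval_int_poly A z = 0 \<and> eval_int_poly B z = 0"
proof -
  define t where "t = z + z ^ 4"
  have t2: "t\<^sup>2 = 1 - t" using prim5_tau[OF z] by (simp add: t_def)
  have z5: "z ^ 5 = 1" by (rule prim5_pow5[OF z])
  have u3: "u ^ 3 = 1" by (rule prim3_cube[OF u])
  \<comment> \<open>At \<open>z\<close>, \<open>C\<close> is \<open>A\<close> times the complex
    conjugate of \<open>B\<close>; multiplying the relation by this conjugate makes the coefficient
    of \<open>u\<close> real.\<close>
  define C where "C = A * pcompose B (Polynomial.monom 1 4)"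
  obtain Q b0 b1 b2 b3 where B: "B = Phi5 * Q + [:b0, b1, b2, b3:]" using remainder_Phi5 by blast
  obtain Q' e0 e1 e2 e3 where C: "C = Phi5 * Q' + [:e0, e1, e2, e3:]" using remainder_Phi5 by blast
  define c where "c = real_part5 b0 b1 b2 b3"
  define d where "d = tau_part5 b0 b1 b2 b3"
  have BB: "eval_int_poly B z * eval_int_poly B (z ^ 4) = of_int c + of_int d * t"
    using relative_norm5[OF z B] by (simp add: c_def d_def t_def)
  have z16: "z ^ 16 = z" using power_eq_power_mod[OF z5, of 16] by simp
  have 1: "eval_int_poly C z + (of_int c + of_int d * t) * u = 0"
  proof -
    have "(eval_int_poly A z + eval_int_poly B z * u) * eval_int_poly B (z ^ 4) = 0" using AB by simp
    moreover have "eval_int_poly C z = eval_int_poly A z * eval_int_poly B (z ^ 4)"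
      by (simp add: C_def eval_int_poly_hom eval_int_poly_pcompose)
    ultimately show ?thesis using BB by (simp add: algebra_simps)
  qed
  have 2: "eval_int_poly C (z ^ 4) + (of_int c + of_int d * t) * u\<^sup>2 = 0"
  proof -
    have ct: "cnj t = t" by (simp add: t_def prim5_cnj[OF z] z16)
    have "cnj (eval_int_poly C z + (of_int c + of_int d * t) * u) = 0" using 1 by simp
    thus ?thesis by (simp add: cnj_eval_int_poly prim5_cnj[OF z] prim3_cnj[OF u] ct)
  qed
  have y: "prim5 (z ^ 4)" using prim5_power[OF z, of 4] by simp
  have pw: "(z ^ 4)\<^sup>2 = z ^ 3" "(z ^ 4) ^ 3 = z\<^sup>2"
    using power_eq_power_mod[OF z5, of 8] power_eq_power_mod[OF z5, of 12] by (simp_all flip: power_mult)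
  have z23: "z\<^sup>2 - z ^ 3 = (z - z ^ 4) * t"
  proof -
    have "(z - z ^ 4) * t = z\<^sup>2 - z ^ 5 * z ^ 3"
      by (simp add: t_def eval_nat_numeral algebra_simps)
    thus ?thesis by (simp add: z5)
  qed
  define f where "f = e2 - e3"
  \<comment> \<open>Subtracting the complex conjugate relation leaves an equation of imaginary
    parts, which is squared below.\<close>
  have "eval_int_poly C z - eval_int_poly C (z ^ 4) = (z - z ^ 4) * of_int e1 + (z\<^sup>2 - z ^ 3) * of_int f"
    unfolding C eval_remainder_Phi5[OF z] eval_remainder_Phi5[OF y] pw
    by (simp add: f_def algebra_simps)
  hence "(z - z ^ 4) * (of_int e1 + of_int f * t) = eval_int_poly C z - eval_int_poly C (z ^ 4)"
    unfolding z23 by (simp only: distrib_left distrib_right mult_ac)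
  also have "\<dots> = - (of_int c + of_int d * t) * u - - (of_int c + of_int d * t) * u\<^sup>2"
    using 1[folded eq_neg_iff_add_eq_0] 2[folded eq_neg_iff_add_eq_0] by (simp only: mult_minus_left)
  finally have 3: "(z - z ^ 4) * (of_int e1 + of_int f * t) = - (of_int c + of_int d * t) * (u - u\<^sup>2)"
    by (simp only: right_diff_distrib)
  have sq1: "(z - z ^ 4)\<^sup>2 = - 3 - t"
  proof -
    have "(z - z ^ 4)\<^sup>2 = t\<^sup>2 - 4 * z ^ 5"
      by (simp add: t_def power2_eq_square algebra_simps eval_nat_numeral)
    thus ?thesis by (simp add: t2 z5)
  qed
  have sq2: "(u - u\<^sup>2)\<^sup>2 = - 3"
  proof -
    have "(u - u\<^sup>2)\<^sup>2 = u\<^sup>2 - 2 * u ^ 3 + u ^ 3 * u"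
      by (simp add: power2_eq_square power3_eq_cube algebra_simps)
    also have "\<dots> = (u\<^sup>2 + u + 1) - 3" unfolding u3 by simp
    finally show ?thesis using u by (simp only: prim3_def diff_0)

  qed
  have 4: "(3 + t) * (of_int e1 + of_int f * t)\<^sup>2 = 3 * (of_int c + of_int d * t)\<^sup>2"
  proof -
    have "(- 3 - t) * (of_int e1 + of_int f * t)\<^sup>2 = (of_int c + of_int d * t)\<^sup>2 * (- 3)"
      using arg_cong[OF 3, of "\<lambda>x. x\<^sup>2"] unfolding power_mult_distrib sq1 sq2 power2_minus .
    moreover have "(3 + t) * x = 3 * y" if "(- 3 - t) * x = y * (- 3)" for x y
    proof -
      have "(3 + t) * x = - ((- 3 - t) * x)" by (simp add: algebra_simps)
      thus ?thesis unfolding that by simp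
    qed
    ultimately show ?thesis by blast
  qed
  \<comment> \<open>\<open>X\<close> and \<open>Y\<close> are the coordinates, in the basis 1,
    \<open>t\<close>, of the difference of the two sides of 4. Their vanishing transfers 4 to the
    conjugate root \<open>- 1 - t\<close>.\<close>
  define X where "X = 3 * e1\<^sup>2 + 2 * e1 * f + 2 * f\<^sup>2 - 3 * (c\<^sup>2 + d\<^sup>2)"
  define Y where "Y = e1\<^sup>2 + 4 * e1 * f - f\<^sup>2 - 3 * (2 * c * d - d\<^sup>2)"
  have XY: "of_int X + of_int Y * s
      = (3 + s) * (of_int e1 + of_int f * s)\<^sup>2 - 3 * (of_int c + of_int d * s)\<^sup>2"
    if "s\<^sup>2 = 1 - s" for s :: complex
  proof -
    have s3: "s ^ 3 = 2 * s - 1"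
    proof -
      have "s ^ 3 = s * s\<^sup>2" by (simp add: power2_eq_square power3_eq_cube)
      also have "\<dots> = s - s\<^sup>2" unfolding that by (simp add: right_diff_distrib that[unfolded power2_eq_square])
      finally show ?thesis by (simp add: that)
    qed
    have "(3 + s) * (of_int e1 + of_int f * s)\<^sup>2 - 3 * (of_int c + of_int d * s)\<^sup>2
      = 3 * of_int e1 ^ 2 - 3 * of_int c ^ 2
        + (6 * of_int e1 * of_int f + of_int e1 ^ 2 - 6 * of_int c * of_int d) * s
        + (3 * of_int f ^ 2 + 2 * of_int e1 * of_int f - 3 * of_int d ^ 2) * s\<^sup>2 + of_int f ^ 2 * s ^ 3"
      by (simp add: power2_eq_square power3_eq_cube algebra_simps)
    also have "\<dots> = of_int X + of_int Y * s"
      unfolding that s3 X_def Y_def by (simp add: algebra_simps)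
    finally show ?thesis by simp
  qed
  have "X = 0 \<and> Y = 0"
    by (rule golden_independent[OF t2]) (simp only: XY[OF t2] 4 diff_self)
  moreover have t2': "(- 1 - t)\<^sup>2 = 1 - (- 1 - t)"
    using t2 by (simp add: power2_eq_square algebra_simps)
  ultimately have 5: "(3 + (- 1 - t)) * (of_int e1 + of_int f * (- 1 - t))\<^sup>2
      = 3 * (of_int c + of_int d * (- 1 - t))\<^sup>2"
    using XY[OF t2'] by simp
  \<comment> \<open>Multiplying the conjugate equations takes norms; that of \<open>3 + t\<close> is
    5.\<close>
  have "((3 + t) * (3 + (- 1 - t))) * ((of_int e1 + of_int f * t) * (of_int e1 + of_int f * (- 1 - t)))\<^sup>2
     = 9 * ((of_int c + of_int d * t) * (of_int c + of_int d * (- 1 - t)))\<^sup>2"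
  proof -
    have *: "(a * b) * (x * y)\<^sup>2 = (a * x\<^sup>2) * (b * y\<^sup>2)" for a b x y :: complex
      by (simp only: power_mult_distrib mult_ac)
    show ?thesis unfolding * 4 5 by (simp add: power_mult_distrib)
  qed
  moreover have "(3 + t) * (3 + (- 1 - t)) = 5"
    using t2 by (simp add: power2_eq_square algebra_simps)
  ultimately have "5 * of_int (golden_norm e1 f) ^ 2 = (9 * of_int (golden_norm c d) ^ 2 :: complex)"
    unfolding golden_norm_factor[OF t2] by simp
  hence "of_int (5 * golden_norm e1 f ^ 2) = (of_int ((3 * golden_norm c d) ^ 2) :: complex)"
    by simp
  hence "(3 * golden_norm c d) ^ 2 = 5 * golden_norm e1 f ^ 2"
    unfolding of_int_eq_iff by simp
  from square_eq_5_square[OF this] have "golden_norm c d = 0" by simp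
  hence "eval_int_poly B z * cnj (eval_int_poly B z) = 0"
    unfolding cnj_eval_int_poly prim5_cnj[OF z] BB using golden_norm_eq_0[of c d] by simp
  thus ?thesis using AB by simp
qed

subsection \<open>The fifteenth roots of unity\<close>

lemma omega_power_cis: "omega n ^ k = cis (2 * pi * real k / real n)"
proof -
  have "omega n = cis (2 * pi / real n)" by (simp add: omega_def cis_conv_exp mult_ac)
  thus ?thesis by (simp add: DeMoivre mult_ac)
qed

lemma bij_betw_omega_power: "n > 0 \<Longrightarrow> bij_betw (\<lambda>k. omega n ^ k) {..<n} {z. z ^ n = 1}"
  unfolding omega_power_cis by (rule bij_betw_roots_unity)

lemma omega15_pow: "omega 15 ^ 15 = 1"
  by (simp add: omega_power_cis)

lemma omega3_eq: "omega 3 = omega 15 ^ 5"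
  using omega_power_cis[of 3 1] by (simp add: omega_power_cis)

lemma omega5_eq: "omega 5 = omega 15 ^ 3"
  using omega_power_cis[of 5 1] by (simp add: omega_power_cis)

lemma omega15_power_mod: "omega 15 ^ k = omega 15 ^ (k mod 15)"
  by (rule power_eq_power_mod[OF omega15_pow])

lemma omega15_power_eq_1: assumes "omega 15 ^ k = 1" shows "15 dvd k"
proof -
  have inj: "inj_on (\<lambda>k. omega 15 ^ k) {..<15}"
    using bij_betw_omega_power[of 15] by (simp add: bij_betw_def)
  have "omega 15 ^ (k mod 15) = omega 15 ^ 0" using assms omega15_power_mod[of k] by simp
  hence "k mod 15 = 0" using inj_onD[OF inj, of "k mod 15" 0] by simp
  thus ?thesis by auto
qed

lemma prim3_iff: "prim3 u \<longleftrightarrow> u ^ 3 = 1 \<and> u \<noteq> 1"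
proof -
  have "u ^ 3 - 1 = (u - 1) * (u\<^sup>2 + u + 1)"
    by (simp add: algebra_simps eval_nat_numeral)
  thus ?thesis using prim3_cube[of u] by (auto simp: prim3_def)
qed

lemma prim5_iff: "prim5 z \<longleftrightarrow> z ^ 5 = 1 \<and> z \<noteq> 1"
proof -
  have "z ^ 5 - 1 = (z - 1) * (z ^ 4 + z ^ 3 + z\<^sup>2 + z + 1)"
    by (simp add: algebra_simps eval_nat_numeral)
  thus ?thesis using prim5_pow5[of z] by (auto simp: prim5_def)
qed

lemma prim3_omega15_power: assumes "\<not> 3 dvd k" shows "prim3 (omega 15 ^ (5 * k))"
proof -
  have "(omega 15 ^ (5 * k)) ^ 3 = (omega 15 ^ 15) ^ k" by (simp flip: power_mult add: mult_ac)
  moreover have "\<not> 15 dvd 5 * k" using assms by presburger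
  ultimately show ?thesis unfolding prim3_iff using omega15_power_eq_1[of "5 * k"] omega15_pow by auto
qed

lemma prim5_omega15_power: assumes "\<not> 5 dvd k" shows "prim5 (omega 15 ^ (3 * k))"
proof -
  have "(omega 15 ^ (3 * k)) ^ 5 = (omega 15 ^ 15) ^ k" by (simp flip: power_mult add: mult_ac)
  moreover have "\<not> 15 dvd 3 * k" using assms by presburger
  ultimately show ?thesis unfolding prim5_iff using omega15_power_eq_1[of "3 * k"] omega15_pow by auto
qed

text \<open>Horner's scheme with \<open>u * u = - u - 1\<close>, so \<open>A\<close> and
  \<open>B\<close> serve all \<open>u\<close>. Putting 1 for \<open>u\<close> in the reduced form
  changes \<open>P\<close> by a multiple of the value 3 of \<open>u ^ 2 + u + 1\<close>;
  \<open>C\<close> records it.\<close>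

lemma split_prim3:
  "\<exists>A B C. (\<forall>u v. prim3 u \<longrightarrow> eval_int_poly P (u * v) = eval_int_poly A v + eval_int_poly B v * u)
     \<and> P = A + B + [:3:] * C"
proof (induction P)
  case 0
  show ?case by (intro exI[of _ 0]) simp
next
  case (pCons a P)
  then obtain A B C where AB: "\<And>u v. prim3 u \<Longrightarrow> eval_int_poly P (u * v) = eval_int_poly A v + eval_int_poly B v * u"
    and C: "P = A + B + [:3:] * C" by blast
  have "eval_int_poly (pCons a P) (u * v)
      = eval_int_poly (pCons a (- B)) v + eval_int_poly (pCons 0 (A - B)) v * u" if "prim3 u" for u v
  proof -
    have u2: "u * u = - u - 1"
    proof -
      have "u * u = (u\<^sup>2 + u + 1) - u - 1" by (simp add: power2_eq_square)
      thus ?thesis using that by (simp only: prim3_def diff_0)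
    qed
    have "eval_int_poly (pCons a P) (u * v)
        = of_int a + v * (eval_int_poly A v * u + eval_int_poly B v * (u * u))"
      by (simp add: AB[OF that] algebra_simps)
    thus ?thesis unfolding u2 by (simp add: eval_int_poly_hom algebra_simps)
  qed
  moreover have "pCons a P = pCons a (- B) + pCons 0 (A - B) + [:3:] * pCons 0 (B + C)"
  proof -
    have "Polynomial.smult 3 B = B + B + B"
      by (rule poly_eqI) (simp only: coeff_smult coeff_add)
    thus ?thesis unfolding C by (simp add: smult_add_right)
  qed
  ultimately show ?case by blast
qed

text \<open>Chinese remainder theorem for exponents: \<open>10 + 6 = 16\<close> is 1 modulo
  15.\<close>

lemma omega15_split: "omega 15 ^ j = omega 15 ^ (5 * (2 * j)) * omega 15 ^ (3 * (2 * j))"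
proof -
  have "16 * j mod 15 = (j + 15 * j) mod 15" by simp
  also have "\<dots> = j mod 15" by (rule mod_mult_self2)
  finally have "16 * j mod 15 = j mod 15" .
  hence "omega 15 ^ j = omega 15 ^ (16 * j)"
    by (metis omega15_power_mod)
  also have "16 * j = 5 * (2 * j) + 3 * (2 * j)" by simp
  finally show ?thesis by (simp only: power_add)
qed

text \<open>Stands in for irreducibility of the fifteenth cyclotomic polynomial: by independence
  \<open>A\<close> and \<open>B\<close> vanish at the fifth root \<open>v\<close>, hence at
  \<open>v ^ j\<close>, and they recombine with \<open>u ^ j\<close>.\<close>

lemma eval_0_omega15_power:
  assumes P: "eval_int_poly P (omega 15) = 0" and j: "\<not> 3 dvd j" "\<not> 5 dvd j"
  shows "eval_int_poly P (omega 15 ^ j) = 0"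
proof -
  obtain A B where AB: "\<And>u v. prim3 u \<Longrightarrow> eval_int_poly P (u * v) = eval_int_poly A v + eval_int_poly B v * u"
    using split_prim3[of P] by blast
  define v where "v = omega 15 ^ (3 * (2 * 1))"
  define u where "u = omega 15 ^ (5 * (2 * 1))"
  have u: "prim3 u" unfolding u_def by (rule prim3_omega15_power) simp
  have v: "prim5 v" unfolding v_def by (rule prim5_omega15_power) simp
  have "omega 15 = u * v" using omega15_split[of 1] by (simp add: u_def v_def)
  hence "eval_int_poly A v + eval_int_poly B v * u = 0" using AB[OF u, of v] P by simp
  from prim3_prim5_independent[OF v u this]
  have 0: "eval_int_poly A v = 0" "eval_int_poly B v = 0" by auto
  have "v ^ j = v ^ (j mod 5)" by (rule power_eq_power_mod[OF prim5_pow5[OF v]])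
  moreover have "j mod 5 \<in> {1, 2, 3, 4}" using j(2) by auto presburger
  ultimately have A: "eval_int_poly A (v ^ j) = 0" and B: "eval_int_poly B (v ^ j) = 0"
    using eval_0_prim5_power[OF v] 0 by simp_all
  have uj: "prim3 (u ^ j)"
  proof -
    have "u ^ j = omega 15 ^ (5 * (2 * j))" by (simp add: u_def mult_ac flip: power_mult)
    moreover have "\<not> 3 dvd 2 * j" using j(1) by presburger
    ultimately show ?thesis using prim3_omega15_power[of "2 * j"] by (simp only: not_False_eq_True)
  qed
  have "omega 15 ^ j = u ^ j * v ^ j"
    unfolding power_mult_distrib[symmetric] \<open>omega 15 = u * v\<close>[symmetric] ..
  thus ?thesis using AB[OF uj, of "v ^ j"] A B by simp
qed

section \<open>The norms of \<open>F\<close> over the divisors of 15\<close>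

lemma coprime_index_sets:
  "{j::nat. 1 \<le> j \<and> j \<le> 3 \<and> gcd j 3 = 1} = {1, 2}"
  "{j::nat. 1 \<le> j \<and> j \<le> 5 \<and> gcd j 5 = 1} = {1, 2, 3, 4}"
  "{j::nat. 1 \<le> j \<and> j \<le> 15 \<and> gcd j 15 = 1} = {1, 2, 4, 7, 8, 11, 13, 14}"
proof -
  have *: "{j::nat. 1 \<le> j \<and> j \<le> n \<and> gcd j n = 1} = set (filter (\<lambda>j. gcd j n = 1) [1..<Suc n])" for n
    by auto
  show "{j::nat. 1 \<le> j \<and> j \<le> 3 \<and> gcd j 3 = 1} = {1, 2}"
    "{j::nat. 1 \<le> j \<and> j \<le> 5 \<and> gcd j 5 = 1} = {1, 2, 3, 4}"
    "{j::nat. 1 \<le> j \<and> j \<le> 15 \<and> gcd j 15 = 1} = {1, 2, 4, 7, 8, 11, 13, 14}"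
    unfolding * by code_simp+
qed

lemma N_prod_3: "N_prod 3 F = eval_norm3 F (omega 15 ^ 5)"
  by (simp add: N_prod_def coprime_index_sets[simplified] omega3_eq eval_norm3_def)

lemma N_prod_5: "N_prod 5 F = eval_norm5 F (omega 15 ^ 3)"
  by (simp add: N_prod_def coprime_index_sets[simplified] omega5_eq eval_norm5_def mult_ac)

lemma N_prod_15:
  "N_prod 15 F = (\<Prod>j\<in>{1, 2, 4, 7, 8, 11, 13, 14}. eval_int_poly F (omega 15 ^ j))"
  unfolding N_prod_def coprime_index_sets ..

lemma M_prod_15:
  "M_prod 15 F = of_int (poly F 1) * N_prod 3 F * N_prod 5 F * N_prod 15 F"
proof -
  have "{1..15::nat} = {1,2,3,4,5,6,7,8,9,10,11,12,13,14,15}" by code_simp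
  moreover have "eval_int_poly F (omega 15 ^ 15) = of_int (poly F 1)"
    using eval_int_poly_at_int[of F 1] by (simp add: omega15_pow)
  ultimately show ?thesis
    by (simp add: M_prod_def N_prod_3 N_prod_5 N_prod_15 eval_norm3_def eval_norm5_def mult_ac
        flip: power_mult)
qed

text \<open>The norm at 15 is taken in two stages: first \<open>H\<close>, the product over the two
  cube roots of unity, then the quintic norm of \<open>H\<close>. Both congruences for
  \<open>n15\<close> follow, as \<open>H\<close> is \<open>F ^ 2\<close> modulo 3 and has value
  \<open>n3\<close> at 1.\<close>

lemma norm_integers:
  assumes F3: "F = Phi3 * Q + [:b0, b1:]" and F5: "F = Phi5 * Q' + [:a0, a1, a2, a3:]"
  defines "n3 \<equiv> b0\<^sup>2 - b0 * b1 + b1\<^sup>2" and "n5 \<equiv> norm5 a0 a1 a2 a3"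
  shows "N_prod 3 F = of_int n3" "N_prod 5 F = of_int n5"
    "[n3 = poly F 1 ^ 2] (mod 3)" "[n5 = poly F 1 ^ 4] (mod 5)"
    "\<exists>n15. N_prod 15 F = of_int n15 \<and> [n15 = n5\<^sup>2] (mod 3) \<and> [n15 = n3 ^ 4] (mod 5)"
    "n3 \<ge> 0" "n5 \<ge> 0"
proof -
  define u where "u = omega 15 ^ 5"
  define v where "v = omega 15 ^ 6"
  have u: "prim3 u" using prim3_omega15_power[of 1] by (simp add: u_def)
  have z: "prim5 (omega 15 ^ 3)" using prim5_omega15_power[of 1] by simp
  have v: "prim5 v" using prim5_omega15_power[of 2] by (simp add: v_def)
  show N3: "N_prod 3 F = of_int n3"
    unfolding N_prod_3 n3_def using eval_norm3_eq[OF u F3] by (simp add: u_def)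
  show N5: "N_prod 5 F = of_int n5"
    unfolding N_prod_5 n5_def by (rule eval_norm5_eq[OF z F5])
  show "[n3 = poly F 1 ^ 2] (mod 3)"
  proof -
    have "poly F 1 = b0 + b1 + 3 * poly Q 1" unfolding F3 by simp
    hence "n3 - poly F 1 ^ 2 = 3 * (- b0 * b1 - 2 * (b0 + b1) * poly Q 1 - 3 * poly Q 1 ^ 2)"
      by (simp add: n3_def power2_eq_square algebra_simps)
    thus ?thesis by (metis cong_iff_dvd_diff dvd_triv_left)
  qed
  have sum5: "[poly P 1 = h0 + h1 + h2 + h3] (mod 5)" if "P = Phi5 * Q + [:h0, h1, h2, h3:]"
    for P Q and h0 h1 h2 h3 :: int
    unfolding that by (simp add: cong_iff_dvd_diff)
  have pow5: "[norm5 h0 h1 h2 h3 = poly P 1 ^ 4] (mod 5)" if "P = Phi5 * Q + [:h0, h1, h2, h3:]"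
    for P Q and h0 h1 h2 h3 :: int
    using norm5_cong_power4[of h0 h1 h2 h3] cong_pow[OF sum5[OF that], of 4]
    by (meson cong_sym cong_trans)
  show "[n5 = poly F 1 ^ 4] (mod 5)" unfolding n5_def by (rule pow5[OF F5])
  show "n3 \<ge> 0"
  proof -
    have "4 * n3 = (2 * b0 - b1)\<^sup>2 + 3 * b1\<^sup>2" by (simp add: n3_def power2_eq_square algebra_simps)
    moreover have "(2 * b0 - b1)\<^sup>2 + 3 * b1\<^sup>2 \<ge> 0" by simp
    ultimately show ?thesis by linarith
  qed
  show "n5 \<ge> 0" using eval_norm5_nonneg[OF z, of F n5] N5 by (simp add: N_prod_5)
  obtain A B C where AB: "\<And>u v. prim3 u \<Longrightarrow> eval_int_poly F (u * v) = eval_int_poly A v + eval_int_poly B v * u"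
    and C: "F = A + B + [:3:] * C" using split_prim3[of F] by blast
  define H where "H = A * A - A * B + B * B"
  have H: "eval_int_poly F (u * y) * eval_int_poly F (u\<^sup>2 * y) = eval_int_poly H y" for y
  proof -
    have u2: "prim3 (u\<^sup>2)" using prim3_omega15_power[of 2] by (simp add: u_def flip: power_mult)
    have "(a + b * u) * (a + b * u\<^sup>2) = a * a + a * b * ((u\<^sup>2 + u + 1) - 1) + b * b * u ^ 3" for a b
      by (simp add: algebra_simps power2_eq_square power3_eq_cube)
    hence "(a + b * u) * (a + b * u\<^sup>2) = a * a - a * b + b * b" for a b
      unfolding u[unfolded prim3_def] prim3_cube[OF u] by simp
    thus ?thesis unfolding AB[OF u] AB[OF u2] by (simp add: H_def eval_int_poly_hom)
  qed
  have N15: "N_prod 15 F = eval_norm5 H v"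
  proof -
    \<comment> \<open>The products of \<open>u\<close> and its square with the four powers of
      \<open>v\<close> run through the exponents prime to 15.\<close>
    have "u * v = omega 15 ^ 11" "u\<^sup>2 * v = omega 15 ^ 1"
      "u * v\<^sup>2 = omega 15 ^ 2" "u\<^sup>2 * v\<^sup>2 = omega 15 ^ 7"
      "u * v ^ 3 = omega 15 ^ 8" "u\<^sup>2 * v ^ 3 = omega 15 ^ 13"
      "u * v ^ 4 = omega 15 ^ 14" "u\<^sup>2 * v ^ 4 = omega 15 ^ 4"
      using omega15_power_mod[of 16] omega15_power_mod[of 17] omega15_power_mod[of 22]
        omega15_power_mod[of 23] omega15_power_mod[of 28] omega15_power_mod[of 29]
        omega15_power_mod[of 34]
      by (simp_all add: u_def v_def flip: power_mult power_add)
    note e = this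
    show ?thesis unfolding eval_norm5_def H[symmetric] e N_prod_15
      by (simp add: mult_ac)
  qed
  obtain R h0 h1 h2 h3 where h: "H = Phi5 * R + [:h0, h1, h2, h3:]" using remainder_Phi5 by blast
  define n15 where "n15 = norm5 h0 h1 h2 h3"
  have "N_prod 15 F = of_int n15"
    unfolding N15 n15_def by (rule eval_norm5_eq[OF v h])
  moreover have "[n15 = n3 ^ 4] (mod 5)"
  proof -
    have "complex_of_int (poly H 1) = of_int n3"
      using H[of 1] eval_norm3_eq[OF u F3] eval_int_poly_at_int[of H 1]
      by (simp add: eval_norm3_def n3_def)
    hence "poly H 1 = n3" unfolding of_int_eq_iff .
    thus ?thesis unfolding n15_def using pow5[OF h] by simp
  qed
  moreover have "[n15 = n5\<^sup>2] (mod 3)"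
  proof -
    \<comment> \<open>From \<open>H = (A + B) ^ 2 - 3 * A * B\<close> and
      \<open>A + B = F - 3 * C\<close>.\<close>
    define K where "K = - (A * B) - [:2:] * (F * C) + [:3:] * (C * C)"
    have K: "H = F * F + [:3:] * K"
    proof -
      have AB': "A + B = F - [:3:] * C" using C by simp
      have "[:3:] = [:2:] + (1 :: int poly)" "[:3:] = (1 + 1 + 1 :: int poly)" "[:2:] = (1 + 1 :: int poly)"
        by (simp_all add: one_pCons)
      hence "H = (A + B) * (A + B) - [:3:] * (A * B)" by (simp add: H_def algebra_simps)
      also have "\<dots> = F * F + [:3:] * K"
        unfolding AB' K_def \<open>[:3:] = (1 + 1 + 1 :: int poly)\<close> \<open>[:2:] = (1 + 1 :: int poly)\<close>
        by (simp add: algebra_simps)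
      finally show ?thesis .
    qed
    obtain S f0 f1 f2 f3 where f: "F * F = Phi5 * S + [:f0, f1, f2, f3:]" using remainder_Phi5 by blast
    obtain S' k0 k1 k2 k3 where k: "K = Phi5 * S' + [:k0, k1, k2, k3:]" using remainder_Phi5 by blast
    have "H = Phi5 * (S + [:3:] * S') + [:f0 + 3 * k0, f1 + 3 * k1, f2 + 3 * k2, f3 + 3 * k3:]"
    proof -
      have "H = Phi5 * S + [:f0, f1, f2, f3:] + [:3:] * (Phi5 * S' + [:k0, k1, k2, k3:])"
        unfolding K f k ..
      also have "\<dots> = Phi5 * (S + [:3:] * S') + ([:f0, f1, f2, f3:] + [:3:] * [:k0, k1, k2, k3:])"
        by (simp only: distrib_left mult.left_commute add_ac)
      finally show ?thesis by simp
    qed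
    from eval_norm5_eq[OF v this]
    have "eval_norm5 H v = of_int (norm5 (f0 + 3 * k0) (f1 + 3 * k1) (f2 + 3 * k2) (f3 + 3 * k3))" .
    hence "complex_of_int n15 = of_int (norm5 (f0 + 3 * k0) (f1 + 3 * k1) (f2 + 3 * k2) (f3 + 3 * k3))"
      unfolding n15_def eval_norm5_eq[OF v h] .
    hence n15: "n15 = norm5 (f0 + 3 * k0) (f1 + 3 * k1) (f2 + 3 * k2) (f3 + 3 * k3)"
      unfolding of_int_eq_iff .
    \<comment> \<open>The root is \<open>v\<close> here and \<open>omega 15 ^ 3\<close> in
      \<open>N_prod_5\<close>; by \<open>eval_norm5_eq\<close> both give \<open>n5\<close>.\<close>
    have "eval_norm5 (F * F) v = eval_norm5 F v * eval_norm5 F v"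
      by (simp add: eval_norm5_def eval_int_poly_mult)
    hence "complex_of_int (norm5 f0 f1 f2 f3) = of_int (n5\<^sup>2)"
      unfolding eval_norm5_eq[OF v f] eval_norm5_eq[OF v F5] by (simp add: n5_def power2_eq_square)
    hence "norm5 f0 f1 f2 f3 = n5\<^sup>2" unfolding of_int_eq_iff .
    thus ?thesis using norm5_cong_mod3 unfolding n15 by metis
  qed
  ultimately show "\<exists>n15. N_prod 15 F = of_int n15 \<and> [n15 = n5\<^sup>2] (mod 3) \<and> [n15 = n3 ^ 4] (mod 5)"
    by blast
qed

subsection \<open>The norm as a product over the embeddings\<close>

lemma clear_denominators:
  "\<exists>d P. d \<noteq> (0::int) \<and> (\<forall>z::complex. of_int d * poly (map_poly of_rat p) z = eval_int_poly P z)"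
proof (induction p)
  case 0
  show ?case by (intro exI[of _ 1] exI[of _ 0]) simp
next
  case (pCons r p)
  then obtain d P where d: "d \<noteq> 0" and P: "\<And>z::complex. of_int d * poly (map_poly of_rat p) z = eval_int_poly P z"
    by blast
  obtain a b where r: "r = Fract a b" "b > 0" by (cases r) auto
  have ab: "of_int b * of_rat r = (of_int a :: complex)" using r(2) by (simp add: r(1) of_rat_rat)
  have "of_int (d * b) * poly (map_poly of_rat (pCons r p)) z
      = eval_int_poly (pCons (d * a) (Polynomial.smult b P)) z" for z :: complex
  proof -
    have "of_int (d * b) * poly (map_poly of_rat (pCons r p)) z
        = of_int d * (of_int b * of_rat r) + z * (of_int b * (of_int d * poly (map_poly of_rat p) z))"
      by (simp add: map_poly_pCons algebra_simps)
    thus ?thesis unfolding ab P by (simp add: eval_int_poly_hom)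
  qed
  moreover have "d * b \<noteq> 0" using d r(2) by simp
  ultimately show ?case by blast
qed

text \<open>With denominators cleared, the transport of zeros of integer polynomials applies to the
  whole field.\<close>

lemma rat_adjoin_eq:
  "rat_adjoin a = {eval_int_poly P a / eval_int_poly Q a | P Q. eval_int_poly Q a \<noteq> 0}"
proof (intro equalityI subsetI)
  fix x assume "x \<in> rat_adjoin a"
  then obtain p q where x: "x = poly (map_poly of_rat p) a / poly (map_poly of_rat q) a"
    and q: "poly (map_poly of_rat q) a \<noteq> 0" by (auto simp: rat_adjoin_def)
  obtain d P where d: "d \<noteq> 0" "of_int d * poly (map_poly of_rat p) a = eval_int_poly P a"
    using clear_denominators[of p] by blast
  obtain e Q where e: "e \<noteq> 0" "of_int e * poly (map_poly of_rat q) a = eval_int_poly Q a"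
    using clear_denominators[of q] by blast
  have nz: "eval_int_poly (Polynomial.smult d Q) a \<noteq> 0"
    using d e q by (simp add: eval_int_poly_hom flip: e(2))
  moreover have "x = eval_int_poly (Polynomial.smult e P) a / eval_int_poly (Polynomial.smult d Q) a"
    using d(1) e(1) q by (simp add: x eval_int_poly_hom flip: e(2) d(2))
  ultimately show "x \<in> {eval_int_poly P a / eval_int_poly Q a | P Q. eval_int_poly Q a \<noteq> 0}" by blast
next
  fix x assume "x \<in> {eval_int_poly P a / eval_int_poly Q a | P Q. eval_int_poly Q a \<noteq> 0}"
  then obtain P Q where x: "x = eval_int_poly P a / eval_int_poly Q a" "eval_int_poly Q a \<noteq> 0" by blast
  have *: "eval_int_poly P z = poly (map_poly of_rat (map_poly of_int P)) z" for P z
    by (simp add: eval_int_poly_def map_poly_map_poly o_def)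
  show "x \<in> rat_adjoin a" using x unfolding * rat_adjoin_def by blast
qed

section \<open>Conjugations of the fifteenth cyclotomic field\<close>

abbreviation units15 :: "nat set" where
  "units15 \<equiv> {1, 2, 4, 7, 8, 11, 13, 14}"

lemma units15_iff: "j < 15 \<Longrightarrow> j \<in> units15 \<longleftrightarrow> \<not> 3 dvd j \<and> \<not> 5 dvd j"
  by (subgoal_tac "\<forall>j\<in>{..<15}. j \<in> units15 \<longleftrightarrow> \<not> 3 dvd j \<and> \<not> 5 dvd j", blast, code_simp)

lemma units15_not_dvd: assumes "j \<in> units15" shows "\<not> 3 dvd j" "\<not> 5 dvd j"
  using units15_iff[of j] assms by auto

lemma eval_0_omega15_units15:
  "eval_int_poly P (omega 15) = 0 \<Longrightarrow> j \<in> units15 \<Longrightarrow> eval_int_poly P (omega 15 ^ j) = 0"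
  using eval_0_omega15_power units15_not_dvd by blast

text \<open>A zero at \<open>omega 15 ^ j\<close> would be carried back to \<open>omega 15\<close>
  by the inverse \<open>i\<close> of \<open>j\<close> modulo 15.\<close>

lemma eval_nonzero_omega15_units15:
  assumes "eval_int_poly Q (omega 15) \<noteq> 0" "j \<in> units15"
  shows "eval_int_poly Q (omega 15 ^ j) \<noteq> 0"
proof
  assume 0: "eval_int_poly Q (omega 15 ^ j) = 0"
  have "\<forall>j\<in>units15. \<exists>i\<in>units15. j * i mod 15 = 1" by code_simp
  then obtain i where i: "i \<in> units15" "j * i mod 15 = 1" using assms(2) by blast
  have "eval_int_poly (pcompose Q (Polynomial.monom 1 j)) (omega 15) = 0"
    using 0 by (simp add: eval_int_poly_pcompose eval_int_poly_hom)
  from eval_0_omega15_units15[OF this i(1)]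
  have "eval_int_poly Q (omega 15 ^ (i * j)) = 0"
    by (simp add: eval_int_poly_pcompose eval_int_poly_hom flip: power_mult)
  moreover have "omega 15 ^ (i * j) = omega 15"
    using omega15_power_mod[of "i * j"] i(2) by (simp add: mult.commute)
  ultimately show False using assms(1) by simp
qed

text \<open>The choice ranges over all fraction representations; \<open>conj15_eq\<close> shows that
  they agree. The restriction supplies the extensionality demanded of embeddings.\<close>

definition conj15 :: "nat \<Rightarrow> complex \<Rightarrow> complex" where
  "conj15 j = restrict (\<lambda>x. SOME y. \<exists>P Q. eval_int_poly Q (omega 15) \<noteq> 0 \<and>
      x = eval_int_poly P (omega 15) / eval_int_poly Q (omega 15) \<and>
      y = eval_int_poly P (omega 15 ^ j) / eval_int_poly Q (omega 15 ^ j)) (rat_adjoin (omega 15))"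

text \<open>For two representations the cross-multiplied difference vanishes at
  \<open>omega 15\<close>, hence at its conjugate, where the denominators stay nonzero.\<close>

lemma conj15_eq:
  assumes Q: "eval_int_poly Q (omega 15) \<noteq> 0" and j: "j \<in> units15"
  shows "conj15 j (eval_int_poly P (omega 15) / eval_int_poly Q (omega 15))
    = eval_int_poly P (omega 15 ^ j) / eval_int_poly Q (omega 15 ^ j)"
proof -
  let ?w = "omega 15" and ?x = "eval_int_poly P (omega 15) / eval_int_poly Q (omega 15)"
  let ?S = "\<lambda>y. \<exists>P' Q'. eval_int_poly Q' ?w \<noteq> 0 \<and> ?x = eval_int_poly P' ?w / eval_int_poly Q' ?w \<and>
      y = eval_int_poly P' (?w ^ j) / eval_int_poly Q' (?w ^ j)"
  have "?x \<in> rat_adjoin ?w" using Q by (auto simp: rat_adjoin_eq)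
  hence "conj15 j ?x = (SOME y. ?S y)" by (simp add: conj15_def)
  also have "\<dots> = eval_int_poly P (?w ^ j) / eval_int_poly Q (?w ^ j)"
  proof (rule some_equality)
    show "?S (eval_int_poly P (?w ^ j) / eval_int_poly Q (?w ^ j))" using Q by blast
  next
    fix y assume "?S y"
    then obtain P' Q' where Q': "eval_int_poly Q' ?w \<noteq> 0" "?x = eval_int_poly P' ?w / eval_int_poly Q' ?w"
      and y: "y = eval_int_poly P' (?w ^ j) / eval_int_poly Q' (?w ^ j)" by blast
    have "eval_int_poly (P * Q' - P' * Q) ?w = 0"
      using Q Q' by (simp add: eval_int_poly_hom frac_eq_eq)
    from eval_0_omega15_units15[OF this j]
    have "eval_int_poly P (?w ^ j) * eval_int_poly Q' (?w ^ j) = eval_int_poly P' (?w ^ j) * eval_int_poly Q (?w ^ j)"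
      by (simp add: eval_int_poly_hom)
    thus "y = eval_int_poly P (?w ^ j) / eval_int_poly Q (?w ^ j)"
      using eval_nonzero_omega15_units15[OF Q j] eval_nonzero_omega15_units15[OF Q'(1) j]
      by (simp add: y frac_eq_eq)
  qed
  finally show ?thesis .
qed

lemma conj15_eval: "j \<in> units15 \<Longrightarrow> conj15 j (eval_int_poly P (omega 15)) = eval_int_poly P (omega 15 ^ j)"
  using conj15_eq[of 1 j P] by simp

lemma conj15_embedding:
  assumes j: "j \<in> units15"
  shows "conj15 j \<in> complex_embeddings (rat_adjoin (omega 15))"
proof -
  have "conj15 j (x + y) = conj15 j x + conj15 j y \<and> conj15 j (x * y) = conj15 j x * conj15 j y"
    if xy: "x \<in> rat_adjoin (omega 15)" "y \<in> rat_adjoin (omega 15)" for x y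
  proof -
    let ?w = "omega 15"
    obtain P Q where P: "x = eval_int_poly P ?w / eval_int_poly Q ?w" "eval_int_poly Q ?w \<noteq> 0"
      using xy(1) by (auto simp: rat_adjoin_eq)
    obtain P' Q' where P': "y = eval_int_poly P' ?w / eval_int_poly Q' ?w" "eval_int_poly Q' ?w \<noteq> 0"
      using xy(2) by (auto simp: rat_adjoin_eq)
    have nz: "eval_int_poly (Q * Q') ?w \<noteq> 0" using P P' by (simp add: eval_int_poly_hom)
    have s: "x + y = eval_int_poly (P * Q' + P' * Q) ?w / eval_int_poly (Q * Q') ?w"
      using P P' by (simp add: eval_int_poly_hom add_frac_eq)
    have p: "x * y = eval_int_poly (P * P') ?w / eval_int_poly (Q * Q') ?w"
      using P P' by (simp add: eval_int_poly_hom)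
    show ?thesis
      unfolding s p conj15_eq[OF nz j] unfolding P(1) P'(1) conj15_eq[OF P(2) j] conj15_eq[OF P'(2) j]
      using eval_nonzero_omega15_units15[OF P(2) j] eval_nonzero_omega15_units15[OF P'(2) j]
      by (simp add: eval_int_poly_hom add_frac_eq)
  qed
  moreover have "conj15 j 1 = 1" using conj15_eval[OF j, of 1] by simp
  ultimately show ?thesis by (simp add: complex_embeddings_def conj15_def)
qed

lemma eval_mem_rat_adjoin: "eval_int_poly P a \<in> rat_adjoin a"
proof -
  have "eval_int_poly P a = eval_int_poly P a / eval_int_poly 1 a" "eval_int_poly 1 a \<noteq> 0" by simp_all
  thus ?thesis unfolding rat_adjoin_eq by blast
qed

lemma embedding_eval:
  assumes s: "s \<in> complex_embeddings (rat_adjoin a)"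
  shows "s (eval_int_poly P a) = eval_int_poly P (s a)"
proof -
  have s1: "s 1 = 1"
    and add: "\<And>P Q. s (eval_int_poly P a + eval_int_poly Q a) = s (eval_int_poly P a) + s (eval_int_poly Q a)"
    and mult: "\<And>P Q. s (eval_int_poly P a * eval_int_poly Q a) = s (eval_int_poly P a) * s (eval_int_poly Q a)"
    using s eval_mem_rat_adjoin by (simp_all add: complex_embeddings_def)
  have s0: "s 0 = 0" using add[of 0 0] by simp
  have nat: "s (of_nat n) = of_nat n" for n
  proof (induction n)
    case (Suc n)
    thus ?case using add[of 1 "[:int n:]"] by (simp add: s1)
  qed (simp add: s0)
  have int: "s (of_int c) = of_int c" for c
  proof (cases "c \<ge> 0")
    case True
    thus ?thesis using nat[of "nat c"] by simp
  next
    case False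
    have "s (of_int c) + s (- of_int c) = 0" using add[of "[:c:]" "[:- c:]"] s0 by simp
    moreover have "s (- of_int c) = - of_int c" using False nat[of "nat (- c)"] by simp
    ultimately show ?thesis by simp
  qed
  show ?thesis
  proof (induction P)
    case (pCons c P)
    have "s (eval_int_poly (pCons c P) a) = s (eval_int_poly [:c:] a) + s (a * eval_int_poly P a)"
      using add[of "[:c:]" "[:0, 1:] * P"] by (simp add: eval_int_poly_mult)
    also have "\<dots> = of_int c + s a * s (eval_int_poly P a)"
      using mult[of "[:0, 1:]" P] by (simp add: int)
    finally show ?case by (simp add: pCons)
  qed (simp add: s0)
qed

text \<open>An embedding is determined by the image \<open>y\<close> of \<open>omega 15\<close>,
  which inherits all integer polynomial equations; these make \<open>y\<close> a primitive fifteenth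
  root of unity.\<close>

lemma complex_embeddings_omega15:
  "complex_embeddings (rat_adjoin (omega 15)) = conj15 ` units15"
proof (intro equalityI subsetI)
  fix s assume s: "s \<in> complex_embeddings (rat_adjoin (omega 15))"
  let ?w = "omega 15"
  define y where "y = s ?w"
  have ev: "s (eval_int_poly P ?w) = eval_int_poly P y" for P
    unfolding y_def by (rule embedding_eval[OF s])
  have zero: "eval_int_poly P y = 0" if "eval_int_poly P ?w = 0" for P
    using ev[of P] ev[of 0] that by simp
  have p3: "prim3 (y ^ 5)"
  proof -
    have "prim3 (?w ^ 5)" using prim3_omega15_power[of 1] by simp
    thus ?thesis using zero[of "Polynomial.monom 1 10 + Polynomial.monom 1 5 + 1"]
      by (simp add: prim3_def eval_int_poly_hom flip: power_mult)
  qed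
  have p5: "prim5 (y ^ 3)"
  proof -
    have "prim5 (?w ^ 3)" using prim5_omega15_power[of 1] by simp
    thus ?thesis using zero[of "Polynomial.monom 1 12 + Polynomial.monom 1 9 + Polynomial.monom 1 6 + Polynomial.monom 1 3 + 1"]
      by (simp add: prim5_def eval_int_poly_hom flip: power_mult)
  qed
  have "y ^ 15 = 1" using p3 by (simp add: prim3_iff flip: power_mult)
  then obtain j where j: "j < 15" "y = ?w ^ j"
    using bij_betw_omega_power[of 15] by (auto simp: bij_betw_def image_def)
  have "\<not> 3 dvd j"
  proof
    assume "3 dvd j"
    then obtain i where "j = 3 * i" by blast
    hence "y ^ 5 = (?w ^ 15) ^ i" by (simp add: j(2) mult_ac flip: power_mult)
    thus False using p3 by (simp add: prim3_iff omega15_pow)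
  qed
  moreover have "\<not> 5 dvd j"
  proof
    assume "5 dvd j"
    then obtain i where "j = 5 * i" by blast
    hence "y ^ 3 = (?w ^ 15) ^ i" by (simp add: j(2) mult_ac flip: power_mult)
    thus False using p5 by (simp add: prim5_iff omega15_pow)
  qed
  ultimately have ju: "j \<in> units15" using units15_iff[OF j(1)] by blast
  have "s x = conj15 j x" for x
  proof (cases "x \<in> rat_adjoin ?w")
    case True
    then obtain P Q where PQ: "x = eval_int_poly P ?w / eval_int_poly Q ?w" "eval_int_poly Q ?w \<noteq> 0"
      by (auto simp: rat_adjoin_eq)
    have "s (x * eval_int_poly Q ?w) = s x * s (eval_int_poly Q ?w)"
      using s True eval_mem_rat_adjoin by (simp add: complex_embeddings_def)
    hence "eval_int_poly P y = s x * eval_int_poly Q y" using PQ by (simp add: ev)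
    thus ?thesis unfolding PQ(1) conj15_eq[OF PQ(2) ju] j(2)
      using eval_nonzero_omega15_units15[OF PQ(2) ju] by (simp add: eq_divide_eq PQ(1))
  next
    case False
    have "s \<in> extensional (rat_adjoin ?w)" "conj15 j \<in> extensional (rat_adjoin ?w)"
      using s conj15_embedding[OF ju] by (simp_all only: complex_embeddings_def mem_Collect_eq)
    thus ?thesis using False by (metis extensional_arb)
  qed
  thus "s \<in> conj15 ` units15" using ju by (intro image_eqI[of _ _ j]) auto
qed (use conj15_embedding in blast)

lemma field_norm_omega15:
  "field_norm (rat_adjoin (omega 15)) (eval_int_poly F (omega 15)) = N_prod 15 F"
proof -
  have inj: "inj_on conj15 units15"
  proof (rule inj_onI)
    fix i j assume ij: "i \<in> units15" "j \<in> units15" "conj15 i = conj15 j"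
    have "omega 15 ^ i = omega 15 ^ j"
      using conj15_eval[OF ij(1), of "[:0, 1:]"] conj15_eval[OF ij(2), of "[:0, 1:]"] ij(3) by simp
    moreover have "inj_on (\<lambda>k. omega 15 ^ k) {..<15}"
      using bij_betw_omega_power[of 15] by (simp add: bij_betw_def)
    moreover have "i < 15" "j < 15" using ij(1,2) by auto
    ultimately show "i = j" by (auto dest: inj_onD)
  qed
  show ?thesis
    unfolding field_norm_def complex_embeddings_omega15 prod.reindex[OF inj] N_prod_15
    by (rule prod.cong) (use conj15_eval in auto)
qed

subsection \<open>Congruences in \<open>\<int>[\<omega>\<^sub>1\<^sub>5]\<close>\<close>

text \<open>Congruence modulo a principal ideal of the ring of integers, expressed through
  representing polynomials.\<close>

definition cong15 :: "int poly \<Rightarrow> int poly \<Rightarrow> int poly \<Rightarrow> bool" where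
  "cong15 M P P' \<longleftrightarrow> (\<exists>H. eval_int_poly P (omega 15) - eval_int_poly P' (omega 15)
     = eval_int_poly M (omega 15) * eval_int_poly H (omega 15))"

lemma cong15_eval: "eval_int_poly P (omega 15) = eval_int_poly P' (omega 15) \<Longrightarrow> cong15 M P P'"
  unfolding cong15_def by (rule exI[of _ 0]) simp

lemma cong15_refl [simp]: "cong15 M P P"
  by (rule cong15_eval) simp

lemma cong15_trans [trans]: "cong15 M P P' \<Longrightarrow> cong15 M P' P'' \<Longrightarrow> cong15 M P P''"
proof -
  assume "cong15 M P P'" "cong15 M P' P''"
  then obtain H H' where
    "eval_int_poly P (omega 15) - eval_int_poly P' (omega 15) = eval_int_poly M (omega 15) * eval_int_poly H (omega 15)"
    "eval_int_poly P' (omega 15) - eval_int_poly P'' (omega 15) = eval_int_poly M (omega 15) * eval_int_poly H' (omega 15)"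
    unfolding cong15_def by blast
  hence "eval_int_poly P (omega 15) - eval_int_poly P'' (omega 15) = eval_int_poly M (omega 15) * eval_int_poly (H + H') (omega 15)"
    by (simp add: eval_int_poly_hom algebra_simps)
  thus ?thesis unfolding cong15_def by blast
qed

lemma cong15_sym: "cong15 M P P' \<Longrightarrow> cong15 M P' P"
proof -
  assume "cong15 M P P'"
  then obtain H where
    "eval_int_poly P (omega 15) - eval_int_poly P' (omega 15) = eval_int_poly M (omega 15) * eval_int_poly H (omega 15)"
    unfolding cong15_def by blast
  hence "eval_int_poly P' (omega 15) - eval_int_poly P (omega 15) = eval_int_poly M (omega 15) * eval_int_poly (- H) (omega 15)"
    by (simp add: eval_int_poly_hom algebra_simps)
  thus ?thesis unfolding cong15_def by blast
qed

lemma cong15_add: "cong15 M P P' \<Longrightarrow> cong15 M Q Q' \<Longrightarrow> cong15 M (P + Q) (P' + Q')"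
proof -
  assume "cong15 M P P'" "cong15 M Q Q'"
  then obtain H H' where
    "eval_int_poly P (omega 15) - eval_int_poly P' (omega 15) = eval_int_poly M (omega 15) * eval_int_poly H (omega 15)"
    "eval_int_poly Q (omega 15) - eval_int_poly Q' (omega 15) = eval_int_poly M (omega 15) * eval_int_poly H' (omega 15)"
    unfolding cong15_def by blast
  hence "eval_int_poly (P + Q) (omega 15) - eval_int_poly (P' + Q') (omega 15) = eval_int_poly M (omega 15) * eval_int_poly (H + H') (omega 15)"
    by (simp add: eval_int_poly_hom algebra_simps)
  thus ?thesis unfolding cong15_def by blast
qed

lemma cong15_mult: "cong15 M P P' \<Longrightarrow> cong15 M Q Q' \<Longrightarrow> cong15 M (P * Q) (P' * Q')"
proof -
  let ?e = "\<lambda>P. eval_int_poly P (omega 15)"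
  assume "cong15 M P P'" "cong15 M Q Q'"
  then obtain H H' where H: "?e P - ?e P' = ?e M * ?e H" "?e Q - ?e Q' = ?e M * ?e H'"
    unfolding cong15_def by blast
  have "?e (P * Q) - ?e (P' * Q') = (?e P - ?e P') * ?e Q + ?e P' * (?e Q - ?e Q')"
    by (simp add: eval_int_poly_hom algebra_simps)
  also have "\<dots> = ?e M * ?e (H * Q + P' * H')"
    unfolding H by (simp add: eval_int_poly_hom algebra_simps)
  finally show ?thesis unfolding cong15_def by blast
qed

lemma cong15_power: "cong15 M P P' \<Longrightarrow> cong15 M (P ^ n) (P' ^ n)"
  by (induction n) (simp_all add: cong15_mult)

lemma cong15_modulus: "cong15 M (M * H) 0"
  unfolding cong15_def by (rule exI[of _ H]) (simp add: eval_int_poly_hom)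

text \<open>\<open>(1 - x) * Phi5 = 1 - x ^ 5\<close>, and
  \<open>(1 - y) * (2 + y) = 3 - (y ^ 2 + y + 1)\<close> at \<open>y = omega 15 ^ 5\<close>.\<close>

lemma eval_3_eq: "\<exists>C. 3 = eval_int_poly Phi5 (omega 15) * eval_int_poly C (omega 15)"
proof
  let ?w = "omega 15"
  have "(?w ^ 5)\<^sup>2 + ?w ^ 5 + 1 = 0"
    using prim3_omega15_power[of 1] by (simp add: prim3_def)
  moreover have "eval_int_poly Phi5 ?w * eval_int_poly ([:1, -1:] * [:2, 0, 0, 0, 0, 1:]) ?w
      = 3 - ((?w ^ 5)\<^sup>2 + ?w ^ 5 + 1)"
    by (simp add: eval_nat_numeral algebra_simps)
  ultimately show "3 = eval_int_poly Phi5 ?w * eval_int_poly ([:1, -1:] * [:2, 0, 0, 0, 0, 1:]) ?w"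
    by simp
qed

text \<open>Likewise \<open>(1 - x) * Phi3 = 1 - x ^ 3\<close>; at \<open>y = omega 15 ^ 3\<close>
  the cofactor is \<open>4 + 3 * y + 2 * y ^ 2 + y ^ 3\<close>.\<close>

lemma eval_5_eq: "\<exists>D. 5 = eval_int_poly Phi3 (omega 15) * eval_int_poly D (omega 15)"
proof
  let ?w = "omega 15" and ?D = "[:1, -1:] * [:4, 0, 0, 3, 0, 0, 2, 0, 0, 1:]"
  have "(?w ^ 3) ^ 4 + (?w ^ 3) ^ 3 + (?w ^ 3)\<^sup>2 + ?w ^ 3 + 1 = 0"
    using prim5_omega15_power[of 1] by (simp add: prim5_def)
  moreover have "eval_int_poly Phi3 ?w * eval_int_poly ?D ?w
      = 5 - ((?w ^ 3) ^ 4 + (?w ^ 3) ^ 3 + (?w ^ 3)\<^sup>2 + ?w ^ 3 + 1)"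
    by (simp add: eval_nat_numeral algebra_simps)
  ultimately show "5 = eval_int_poly Phi3 ?w * eval_int_poly ?D ?w" by simp
qed

lemma cong15_3: "cong15 Phi5 ([:3:] * R) 0"
proof -
  obtain C where C: "3 = eval_int_poly Phi5 (omega 15) * eval_int_poly C (omega 15)" using eval_3_eq by blast
  have "eval_int_poly ([:3:] * R) (omega 15) = 3 * eval_int_poly R (omega 15)"
    unfolding eval_int_poly_mult by simp
  also have "\<dots> = eval_int_poly Phi5 (omega 15) * eval_int_poly (C * R) (omega 15)"
    by (subst C) (simp only: eval_int_poly_mult mult_ac)
  finally show ?thesis unfolding cong15_def by (intro exI[of _ "C * R"]) (simp only: eval_int_poly_0 diff_0_right)
qed

lemma cong15_5: "cong15 Phi3 ([:5:] * R) 0"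
proof -
  obtain C where C: "5 = eval_int_poly Phi3 (omega 15) * eval_int_poly C (omega 15)" using eval_5_eq by blast
  have "eval_int_poly ([:5:] * R) (omega 15) = 5 * eval_int_poly R (omega 15)"
    unfolding eval_int_poly_mult by simp
  also have "\<dots> = eval_int_poly Phi3 (omega 15) * eval_int_poly (C * R) (omega 15)"
    by (subst C) (simp only: eval_int_poly_mult mult_ac)
  finally show ?thesis unfolding cong15_def by (intro exI[of _ "C * R"]) (simp only: eval_int_poly_0 diff_0_right)
qed

text \<open>As 3 lies in the ideal of \<open>Phi5\<close>, a congruence reduces to an identity of
  integer polynomials with explicit witnesses \<open>Q\<close>, \<open>R\<close>.\<close>

lemma cong15_Phi5I: "P = Phi5 * Q + [:3:] * R + P' \<Longrightarrow> cong15 Phi5 P P'"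
  using cong15_add[OF cong15_add[OF cong15_modulus cong15_3] cong15_refl, of Q R P']
  by (simp only: add_0_left add_0_right)

lemma cong15_Phi3I: "P = Phi3 * Q + [:5:] * R + P' \<Longrightarrow> cong15 Phi3 P P'"
  using cong15_add[OF cong15_add[OF cong15_modulus cong15_5] cong15_refl, of Q R P']
  by (simp only: add_0_left add_0_right)

lemma cong15_Phi5_coeffs:
  assumes "[a0 = b0] (mod 3)" "[a1 = b1] (mod 3)" "[a2 = b2] (mod 3)" "[a3 = b3] (mod 3)"
  shows "cong15 Phi5 [:a0, a1, a2, a3:] [:b0, b1, b2, b3:]"
proof -
  obtain k0 k1 k2 k3 where "a0 = b0 + 3 * k0" "a1 = b1 + 3 * k1" "a2 = b2 + 3 * k2" "a3 = b3 + 3 * k3"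
    using assms by (metis cong_iff_lin cong_sym)
  thus ?thesis by (intro cong15_Phi5I[of _ 0 "[:k0, k1, k2, k3:]"]) simp
qed

lemma cong15_Phi3_coeffs:
  assumes "[a0 = b0] (mod 5)" "[a1 = b1] (mod 5)"
  shows "cong15 Phi3 [:a0, a1:] [:b0, b1:]"
proof -
  obtain k0 k1 where "a0 = b0 + 5 * k0" "a1 = b1 + 5 * k1"
    using assms by (metis cong_iff_lin cong_sym)
  thus ?thesis by (intro cong15_Phi3I[of _ 0 "[:k0, k1:]"]) simp
qed

subsection \<open>Units of \<open>\<int>[\<omega>\<^sub>1\<^sub>5]\<close>\<close>

definition unit15 :: "int poly \<Rightarrow> bool" where
  "unit15 V \<longleftrightarrow> (\<exists>U. eval_int_poly V (omega 15) * eval_int_poly U (omega 15) = 1)"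

lemma unit15_mult: assumes "unit15 V" "unit15 V'" shows "unit15 (V * V')"
proof -
  obtain U U' where U: "eval_int_poly V (omega 15) * eval_int_poly U (omega 15) = 1"
    "eval_int_poly V' (omega 15) * eval_int_poly U' (omega 15) = 1"
    using assms by (auto simp: unit15_def)
  have "eval_int_poly (V * V') (omega 15) * eval_int_poly (U * U') (omega 15)
      = (eval_int_poly V (omega 15) * eval_int_poly U (omega 15)) * (eval_int_poly V' (omega 15) * eval_int_poly U' (omega 15))"
    by (simp only: eval_int_poly_mult mult_ac)
  thus ?thesis unfolding U unit15_def by auto
qed

lemma unit15_1: "unit15 1"
  unfolding unit15_def by (rule exI[of _ 1]) simp

lemma unit15_power: "unit15 V \<Longrightarrow> unit15 (V ^ n)"
  by (induction n) (simp_all add: unit15_1 unit15_mult)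

lemma unit15_uminus: "unit15 V \<Longrightarrow> unit15 (- V)"
  unfolding unit15_def eval_int_poly_uminus
  by (metis eval_int_poly_uminus minus_mult_minus)

lemma unit15_pcompose_square:
  assumes "unit15 V" shows "unit15 (pcompose V (Polynomial.monom 1 2))"
proof -
  obtain U where "eval_int_poly (V * U - 1) (omega 15) = 0"
    using assms by (auto simp: unit15_def eval_int_poly_hom)
  from eval_0_omega15_units15[OF this, of 2]
  have "eval_int_poly V ((omega 15)\<^sup>2) * eval_int_poly U ((omega 15)\<^sup>2) = 1"
    by (simp add: eval_int_poly_hom)
  thus ?thesis unfolding unit15_def
    by (intro exI[of _ "pcompose U (Polynomial.monom 1 2)"])
       (simp add: eval_int_poly_pcompose eval_int_poly_monom)
qed

text \<open>As \<open>\<Phi>\<^sub>1\<^sub>5(1) = 1\<close>, \<open>x - 1\<close> divides \<open>\<Phi>\<^sub>1\<^sub>5 - 1\<close>, and the cofactor is the inverse up to sign.\<close>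

lemma unit15_x_minus_1: "unit15 [:-1, 1:]"
proof -
  let ?w = "omega 15" and ?U = "[:0, -1, -1, 0, -1, 0, 0, -1:] :: int poly"
  have "?w\<^sup>2 + ?w + 1 \<noteq> 0"
    using omega15_power_eq_1[of 3] prim3_cube[of ?w] by (auto simp: prim3_def)
  \<comment> \<open>\<open>Phi3\<close> times the fifteenth cyclotomic polynomial is
    \<open>x ^ 10 + x ^ 5 + 1\<close>; the nonzero value of \<open>Phi3\<close> cancels.\<close>
  moreover have "(?w\<^sup>2 + ?w + 1) * (eval_int_poly [:-1, 1:] ?w * eval_int_poly ?U ?w - 1)
      = - ((?w ^ 5)\<^sup>2 + ?w ^ 5 + 1)"
    by (simp add: eval_nat_numeral algebra_simps)
  moreover have "(?w ^ 5)\<^sup>2 + ?w ^ 5 + 1 = 0"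
    using prim3_omega15_power[of 1] by (simp add: prim3_def)
  ultimately have "eval_int_poly [:-1, 1:] ?w * eval_int_poly ?U ?w = 1"
    by (metis eq_iff_diff_eq_0 mult_eq_0_iff neg_equal_0_iff_equal)
  thus ?thesis unfolding unit15_def by blast
qed

lemma unit15_x: "unit15 [:0, 1:]"
proof -
  have "omega 15 * omega 15 ^ 14 = 1" using omega15_pow power_Suc[of "omega 15" 14] by simp
  thus ?thesis unfolding unit15_def
    by (intro exI[of _ "Polynomial.monom 1 14"]) (simp add: eval_int_poly_monom)
qed

definition golden_unit :: "int poly" where
  "golden_unit = 1 + Polynomial.monom 1 3 + Polynomial.monom 1 12"

lemma unit15_golden: "unit15 golden_unit"
proof -
  let ?t = "omega 15 ^ 3 + omega 15 ^ 12"
  have "prim5 (omega 15 ^ 3)" using prim5_omega15_power[of 1] by simp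
  from prim5_tau[OF this] have "?t\<^sup>2 = 1 - ?t" by (simp flip: power_mult)
  hence "(1 + ?t) * ?t = 1" by (simp add: distrib_right power2_eq_square)
  thus ?thesis unfolding unit15_def
    by (intro exI[of _ "Polynomial.monom 1 3 + Polynomial.monom 1 12"])
       (simp add: golden_unit_def eval_int_poly_hom add.assoc)
qed

text \<open>Modulo \<open>\<Phi>\<^sub>5(\<omega>)\<close> and 3 this unit is the trivial unit \<open>x\<^sup>4\<close>, whereas modulo \<open>\<Phi>\<^sub>3(\<omega>)\<close> and 5 it is 3,
  which is not a sixth root of unity.\<close>

definition mixed_unit :: "int poly" where
  "mixed_unit = - ([:-1, 1:] * pcompose [:-1, 1:] (Polynomial.monom 1 2) * golden_unit\<^sup>2)"

lemma unit15_mixed: "unit15 mixed_unit"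
  unfolding mixed_unit_def
  by (intro unit15_uminus unit15_mult unit15_power unit15_pcompose_square unit15_x_minus_1 unit15_golden)

lemma mixed_unit_eq: "mixed_unit = - [:-1, 1:] * [:-1, 0, 1:] * golden_unit\<^sup>2"
proof -
  have "pcompose [:-1, 1:] (Polynomial.monom 1 2) = ([:-1, 0, 1:] :: int poly)"
    by (simp add: monom_altdef power2_eq_square pcompose_pCons)
  thus ?thesis by (simp only: mixed_unit_def mult_minus_left)
qed

text \<open>\<open>x ^ 12\<close> reduces to \<open>x ^ 2\<close>, with quotient
  \<open>x ^ 2 * (x - 1) * (x ^ 5 + 1)\<close>.\<close>

lemma golden_unit_mod_Phi5: "cong15 Phi5 golden_unit [:1, 0, 1, 1:]"
  by (rule cong15_Phi5I[of _ "[:0, 0, -1, 1, 0, 0, 0, -1, 1:]" 0])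
     (simp add: golden_unit_def monom_altdef eval_nat_numeral one_pCons)

lemma golden_unit_mod_Phi3: "cong15 Phi3 golden_unit [:3:]"
  by (rule cong15_Phi3I[of _ "[:-1, 1:] * ([:1:] + [:1, 0, 0, 1, 0, 0, 1, 0, 0, 1:])" 0])
     (simp add: golden_unit_def monom_altdef eval_nat_numeral one_pCons)

lemma mixed_unit_mod_Phi5: "cong15 Phi5 mixed_unit [:0, 0, 0, 0, 1:]"
proof -
  have "cong15 Phi5 (- [:-1, 1:] * [:-1, 0, 1:] * golden_unit\<^sup>2) (- [:-1, 1:] * [:-1, 0, 1:] * [:1, 0, 1, 1:]\<^sup>2)"
    by (intro cong15_mult cong15_power cong15_refl golden_unit_mod_Phi5)
  also have "cong15 Phi5 (- [:-1, 1:] * [:-1, 0, 1:] * [:1, 0, 1, 1:]\<^sup>2) [:0, 0, 0, 0, 1:]"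
    by (rule cong15_Phi5I[of _ "[:2, -1, -2, 3, 0, -1:]" "[:-1, 0, 0, -1:]"])
       (simp add: power2_eq_square)
  finally show ?thesis
    by (simp only: mixed_unit_eq)
qed

text \<open>Modulo \<open>Phi3\<close>, \<open>(1 - x) * (x ^ 2 - 1)\<close> is -3 and the golden
  square is 9; their product -27 is 3 modulo 5.\<close>

lemma mixed_unit_mod_Phi3: "cong15 Phi3 mixed_unit [:3:]"
proof -
  have "cong15 Phi3 (- [:-1, 1:] * [:-1, 0, 1:] * golden_unit\<^sup>2) (- [:-1, 1:] * [:-1, 0, 1:] * [:3:]\<^sup>2)"
    by (intro cong15_mult cong15_power cong15_refl golden_unit_mod_Phi3)
  also have "cong15 Phi3 (- [:-1, 1:] * [:-1, 0, 1:] * [:3:]\<^sup>2) [:3:]"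
    by (rule cong15_Phi3I[of _ "[:18, -9:]" "[:-6:]"])
       (simp add: power2_eq_square)
  finally show ?thesis
    by (simp only: mixed_unit_eq)
qed

text \<open>Chinese remainder theorem from \<open>1 = 2 * 3 - 5\<close>, where 3 and 5 are multiples
  of \<open>Phi5\<close> and \<open>Phi3\<close> at \<open>omega 15\<close>. The unit
  \<open>x - 1\<close> is inserted to match the shape of \<open>good_poly\<close>.\<close>

lemma cong15_both:
  assumes "cong15 Phi5 P P'" "cong15 Phi3 P P'"
  shows "cong15 ([:-1, 1:] * Phi3 * Phi5) P P'"
proof -
  let ?w = "omega 15" and ?e = "\<lambda>P. eval_int_poly P (omega 15)"
  obtain H where H: "?e P - ?e P' = ?e Phi5 * ?e H" using assms(1) by (auto simp only: cong15_def)
  obtain H' where H': "?e P - ?e P' = ?e Phi3 * ?e H'" using assms(2) by (auto simp only: cong15_def)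
  obtain C where C: "3 = ?e Phi5 * ?e C" using eval_3_eq by blast
  obtain D where D: "5 = ?e Phi3 * ?e D" using eval_5_eq by blast
  obtain R where R: "?e [:-1, 1:] * ?e R = 1" using unit15_x_minus_1 by (auto simp only: unit15_def)
  have "?e P - ?e P' = 2 * 3 * (?e P - ?e P') - 5 * (?e P - ?e P')" by (simp add: algebra_simps)
  also have "\<dots> = 2 * 3 * (?e Phi3 * ?e H') - 5 * (?e Phi5 * ?e H)" by (simp only: H[symmetric] H'[symmetric])
  also have "\<dots> = 2 * (?e Phi5 * ?e C) * (?e Phi3 * ?e H') - (?e Phi3 * ?e D) * (?e Phi5 * ?e H)"
    by (simp only: C[symmetric] D[symmetric])
  also have "\<dots> = ?e Phi3 * ?e Phi5 * ?e ([:2:] * C * H' - D * H)"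
  proof -
    have "?e [:2:] = 2" by simp
    thus ?thesis by (simp only: eval_int_poly_diff eval_int_poly_mult right_diff_distrib mult_ac)
  qed
  also have "\<dots> = ?e Phi3 * ?e Phi5 * ?e ([:2:] * C * H' - D * H) * (?e [:-1, 1:] * ?e R)"
    unfolding R by simp
  also have "\<dots> = ?e ([:-1, 1:] * Phi3 * Phi5) * ?e (R * ([:2:] * C * H' - D * H))"
    unfolding eval_int_poly_mult[of R] eval_int_poly_mult[of "[:-1, 1:] * Phi3"] eval_int_poly_mult[of "[:-1, 1:]"]
    by (simp only: mult_ac)
  finally show ?thesis unfolding cong15_def by blast
qed

subsection \<open>Good elements\<close>

text \<open>Coordinates of the product of two elements of \<open>\<int>[x]/\<Phi>\<^sub>5\<close>, of the powers of the golden unit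
  modulo 3, and of \<open>x\<^sup>j \<Phi>\<^sub>3\<close>.\<close>

fun mult5 :: "int \<times> int \<times> int \<times> int \<Rightarrow> int \<times> int \<times> int \<times> int \<Rightarrow> int \<times> int \<times> int \<times> int" where
  "mult5 (a0, a1, a2, a3) (b0, b1, b2, b3) =
    (let c4 = a1 * b3 + a2 * b2 + a3 * b1 in
      (a0 * b0 - c4 + a2 * b3 + a3 * b2, a0 * b1 + a1 * b0 - c4 + a3 * b3,
       a0 * b2 + a1 * b1 + a2 * b0 - c4, a0 * b3 + a1 * b2 + a2 * b1 + a3 * b0 - c4))"

definition golden_power5 :: "nat \<Rightarrow> int \<times> int \<times> int \<times> int" where
  "golden_power5 k = [(1, 0, 0, 0), (1, 0, 1, 1), (2, 0, 1, 1), (0, 0, 2, 2)] ! k"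

definition shifted_Phi3 :: "nat \<Rightarrow> int \<times> int \<times> int \<times> int" where
  "shifted_Phi3 j = [(1, 1, 1, 0), (0, 1, 1, 1), (-1, -1, 0, 0), (0, -1, -1, 0), (0, 0, -1, -1)] ! j"

fun poly5 :: "int \<times> int \<times> int \<times> int \<Rightarrow> int poly" where
  "poly5 (a0, a1, a2, a3) = [:a0, a1, a2, a3:]"

fun cong5 :: "int \<times> int \<times> int \<times> int \<Rightarrow> int \<times> int \<times> int \<times> int \<Rightarrow> bool" where
  "cong5 (a0, a1, a2, a3) (b0, b1, b2, b3) \<longleftrightarrow>
    a0 mod 3 = b0 mod 3 \<and> a1 mod 3 = b1 mod 3 \<and> a2 mod 3 = b2 mod 3 \<and> a3 mod 3 = b3 mod 3"

lemma cong5_cong15: "cong5 a b \<Longrightarrow> cong15 Phi5 (poly5 a) (poly5 b)"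
proof -
  obtain a0 a1 a2 a3 b0 b1 b2 b3 where ab: "a = (a0, a1, a2, a3)" "b = (b0, b1, b2, b3)"
    by (metis prod_cases4)
  assume "cong5 a b"
  thus ?thesis unfolding ab poly5.simps cong5.simps
    by (intro cong15_Phi5_coeffs) (simp_all only: cong_def)
qed

lemma poly5_mult5: "cong15 Phi5 (poly5 a * poly5 b) (poly5 (mult5 a b))"
proof -
  obtain a0 a1 a2 a3 b0 b1 b2 b3 where ab: "a = (a0, a1, a2, a3)" "b = (b0, b1, b2, b3)"
    by (metis prod_cases4)
  define c4 c5 c6 where "c4 = a1 * b3 + a2 * b2 + a3 * b1" "c5 = a2 * b3 + a3 * b2" "c6 = a3 * b3"
  show ?thesis unfolding ab
    by (rule cong15_Phi5I[of _ "[:c4 - c5, c5 - c6, c6:]" 0])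
       (simp add: c4_c5_c6_def Let_def algebra_simps)
qed

lemma golden_power5_cong: "k < 4 \<Longrightarrow> cong15 Phi5 (golden_unit ^ k) (poly5 (golden_power5 k))"
proof (induction k)
  case 0
  show ?case by (simp add: golden_power5_def one_pCons)
next
  case (Suc k)
  have "cong15 Phi5 (golden_unit ^ Suc k) (poly5 (1, 0, 1, 1) * poly5 (golden_power5 k))"
    unfolding power_Suc by (intro cong15_mult Suc.IH) (use Suc.prems golden_unit_mod_Phi5 in auto)
  also have "cong15 Phi5 \<dots> (poly5 (mult5 (1, 0, 1, 1) (golden_power5 k)))"
    by (rule poly5_mult5)
  also have "\<forall>k<3. cong5 (mult5 (1, 0, 1, 1) (golden_power5 k)) (golden_power5 (Suc k))"
    by code_simp
  hence "cong15 Phi5 (poly5 (mult5 (1, 0, 1, 1) (golden_power5 k))) (poly5 (golden_power5 (Suc k)))"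
    using Suc.prems by (intro cong5_cong15) simp
  finally show ?case .
qed

lemma shifted_Phi3_cong: "j < 5 \<Longrightarrow> cong15 Phi5 (poly5 (shifted_Phi3 j)) ([:0, 1:] ^ j * Phi3)"
proof (induction j)
  case 0
  show ?case by (simp add: shifted_Phi3_def)
next
  case (Suc j)
  have "\<forall>j<4. cong5 (shifted_Phi3 (Suc j)) (mult5 (0, 1, 0, 0) (shifted_Phi3 j))" by code_simp
  hence "cong15 Phi5 (poly5 (shifted_Phi3 (Suc j))) (poly5 (mult5 (0, 1, 0, 0) (shifted_Phi3 j)))"
    using Suc.prems by (intro cong5_cong15) simp
  also have "cong15 Phi5 \<dots> (poly5 (0, 1, 0, 0) * poly5 (shifted_Phi3 j))"
    by (rule cong15_sym[OF poly5_mult5])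
  also have "cong15 Phi5 \<dots> ([:0, 1:] * ([:0, 1:] ^ j * Phi3))"
    by (intro cong15_mult Suc.IH) (use Suc.prems in auto)
  finally show ?case by (simp only: power_Suc mult.assoc)
qed

text \<open>In the field of 81 elements the norm is the 40th power. The elements of norm 1 form a
  group of order 40 containing \<open>Phi3\<close> and generated by \<open>x\<close> and the golden
  unit, whose fourth power is -1; hence \<open>k < 4\<close> and a sign suffice.\<close>

lemma norm5_mod_3_table:
  "\<forall>a0\<in>{0, 1, 2}. \<forall>a1\<in>{0, 1, 2}. \<forall>a2\<in>{0, 1, 2}. \<forall>a3\<in>{0, 1, 2}. norm5 a0 a1 a2 a3 mod 3 = 1 \<longrightarrow>
     (\<exists>k<4. \<exists>j<5. \<exists>s\<in>{1, -1}. cong5 (mult5 (a0, a1, a2, a3) (golden_power5 k))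
        (mult5 (s, 0, 0, 0) (shifted_Phi3 j)))"
  by code_simp

lemma norm5_mod_3_eq_1:
  assumes F: "F = Phi5 * Q + [:a0, a1, a2, a3:]" and n: "norm5 a0 a1 a2 a3 mod 3 = 1"
  shows "\<exists>k<4. \<exists>j<5. \<exists>s\<in>{1, -1}. cong15 Phi5 (F * golden_unit ^ k) ([:s:] * ([:0, 1:] ^ j * Phi3))"
proof -
  let ?a = "(a0 mod 3, a1 mod 3, a2 mod 3, a3 mod 3)"
  have mod3: "x mod 3 \<in> {0, 1, 2}" for x :: int by auto
  have "[norm5 (a0 mod 3) (a1 mod 3) (a2 mod 3) (a3 mod 3) = norm5 a0 a1 a2 a3] (mod 3)"
    unfolding norm5_def golden_norm_def real_part5_def tau_part5_def
    by (intro cong_add cong_diff cong_mult cong_pow) (simp_all add: cong_def)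
  hence "norm5 (a0 mod 3) (a1 mod 3) (a2 mod 3) (a3 mod 3) mod 3 = 1" using n by (simp add: cong_def)
  then obtain k j s where kjs: "k < 4" "j < 5" "s \<in> {1, -1}"
    and c: "cong5 (mult5 ?a (golden_power5 k)) (mult5 (s, 0, 0, 0) (shifted_Phi3 j))"
    using norm5_mod_3_table mod3 by metis
  have "cong15 Phi5 F [:a0, a1, a2, a3:]"
    by (rule cong15_Phi5I[of _ Q 0]) (simp only: F mult_zero_right add_0_right)
  also have "cong15 Phi5 \<dots> (poly5 ?a)" by (simp add: cong15_Phi5_coeffs cong_def)
  finally have "cong15 Phi5 (F * golden_unit ^ k) (poly5 ?a * poly5 (golden_power5 k))"
    by (intro cong15_mult golden_power5_cong kjs(1))
  also have "cong15 Phi5 \<dots> (poly5 (mult5 ?a (golden_power5 k)))" by (rule poly5_mult5)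
  also have "cong15 Phi5 \<dots> (poly5 (mult5 (s, 0, 0, 0) (shifted_Phi3 j)))" by (rule cong5_cong15[OF c])
  also have "cong15 Phi5 \<dots> (poly5 (s, 0, 0, 0) * poly5 (shifted_Phi3 j))"
    by (rule cong15_sym[OF poly5_mult5])
  also have "cong15 Phi5 \<dots> ([:s:] * ([:0, 1:] ^ j * Phi3))"
    by (intro cong15_mult shifted_Phi3_cong kjs(2)) simp
  finally show ?thesis using kjs by blast
qed

text \<open>In the field of 25 elements, norm 2 or 3 marks the nonsquares. Signs, powers of
  \<open>x\<close> and the scalar 3 generate the 12 squares, so every nonsquare reaches
  \<open>x ^ 2 - 1\<close>, that is \<open>3 + 4 * x\<close>. The triples list the coordinates after
  multiplication by \<open>x ^ i\<close>.\<close>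

lemma norm3_mod_5_table:
  "\<forall>b0\<in>{0, 1, 2, 3, 4}. \<forall>b1\<in>{0, 1, 2, 3, 4}. (b0 * b0 - b0 * b1 + b1 * b1) mod 5 \<in> {2, 3 :: int} \<longrightarrow>
     (\<exists>r\<in>{1, 3}. \<exists>s\<in>{1, -1}. \<exists>(i, c0, c1)\<in>{(0, b0, b1), (1, - b1, b0 - b1), (2 :: nat, b1 - b0, - b0)}.
        s * r * c0 mod 5 = 3 \<and> s * r * c1 mod 5 = 4)"
  by code_simp

lemma norm3_mod_5_eq_2_3:
  assumes n: "(b0\<^sup>2 - b0 * b1 + b1\<^sup>2) mod 5 \<in> {2, 3 :: int}"
  shows "\<exists>l i. \<exists>s\<in>{1, -1}. cong15 Phi3 ([:b0, b1:] * ([:s:] * [:3:] ^ l * [:0, 1:] ^ i)) [:-1, 0, 1:]"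
proof -
  let ?b0 = "b0 mod 5" and ?b1 = "b1 mod 5"
  have mod5: "x mod 5 \<in> {0, 1, 2, 3, 4}" for x :: int by auto
  have "[?b0\<^sup>2 - ?b0 * ?b1 + ?b1\<^sup>2 = b0\<^sup>2 - b0 * b1 + b1\<^sup>2] (mod 5)"
    by (intro cong_add cong_diff cong_mult cong_pow) (simp_all add: cong_def)
  hence "(?b0 * ?b0 - ?b0 * ?b1 + ?b1 * ?b1) mod 5 \<in> {2, 3}"
    using n by (simp only: cong_def power2_eq_square)
  then obtain r s i c0 c1 where r: "r \<in> {1, 3}" and s: "s \<in> {1, -1}"
    and ic: "(i, c0, c1) \<in> {(0, ?b0, ?b1), (1, - ?b1, ?b0 - ?b1), (2 :: nat, ?b1 - ?b0, - ?b0)}"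
    and c: "s * r * c0 mod 5 = 3" "s * r * c1 mod 5 = 4"
    using norm3_mod_5_table[rule_format, OF mod5 mod5, of b0 b1] by blast
  \<comment> \<open>A power of 3 is wanted because the residue 3 will be realised by
    \<open>mixed_unit\<close>.\<close>
  have "r = 3 ^ 0 \<or> r = 3 ^ 1" using r by auto
  then obtain l :: nat where l: "r = 3 ^ l" by blast
  note c = c[unfolded l]
  have "cong15 Phi3 [:b0, b1:] [:?b0, ?b1:]" by (simp add: cong15_Phi3_coeffs cong_def)
  hence "cong15 Phi3 ([:b0, b1:] * [:0, 1:] ^ i) ([:?b0, ?b1:] * [:0, 1:] ^ i)"
    by (intro cong15_mult cong15_refl)
  also have "cong15 Phi3 \<dots> [:c0, c1:]"
  proof -
    consider "i = 0" "c0 = ?b0" "c1 = ?b1" | "i = 1" "c0 = - ?b1" "c1 = ?b0 - ?b1"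
      | "i = 2" "c0 = ?b1 - ?b0" "c1 = - ?b0" using ic by auto
    thus ?thesis
    proof cases
      case 1
      thus ?thesis by simp
    next
      case 2
      thus ?thesis by (intro cong15_Phi3I[of _ "[:?b1:]" 0]) simp
    next
      case 3
      thus ?thesis by (intro cong15_Phi3I[of _ "[:?b0 - ?b1, ?b1:]" 0]) (simp add: power2_eq_square)
    qed
  qed
  finally have "cong15 Phi3 ([:b0, b1:] * [:0, 1:] ^ i * ([:s:] * [:3:] ^ l)) ([:c0, c1:] * ([:s:] * [:3:] ^ l))"
    by (intro cong15_mult cong15_refl)
  also have "[:c0, c1:] * ([:s:] * [:3:] ^ l) = [:s * 3 ^ l * c0, s * 3 ^ l * c1:]"
  proof -
    have "[:s:] * [:3:] ^ l = [:s * 3 ^ l:]" by (simp add: poly_const_pow)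
    thus ?thesis by (simp only:) (simp add: mult_ac)
  qed
  also have "cong15 Phi3 \<dots> [:3, 4:]" using c by (intro cong15_Phi3_coeffs) (simp_all add: cong_def)
  also have "cong15 Phi3 \<dots> [:-1, 0, 1:]"
    by (rule cong15_Phi3I[of _ "[:-1:]" "[:1, 1:]"]) simp
  finally show ?thesis using s by (auto simp only: mult_ac intro!: exI bexI[of _ s])
qed

text \<open>Links the products over complex roots to the integer polynomials; for 5 the inverse
  pairs of roots give two quadratic factors.\<close>

lemma eval_cyclotomic_poly:
  "poly (cyclotomic_poly 3) (omega 15) = eval_int_poly Phi3 (omega 15)"
  "poly (cyclotomic_poly 5) (omega 15) = eval_int_poly Phi5 (omega 15)"
proof -
  let ?w = "omega 15"
  define u where "u = ?w ^ 5"
  define z where "z = ?w ^ 3"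
  have u: "prim3 u" using prim3_omega15_power[of 1] by (simp add: u_def)
  have z: "prim5 z" using prim5_omega15_power[of 1] by (simp add: z_def)
  have "(x - u) * (x - u\<^sup>2) = x\<^sup>2 - x * ((u\<^sup>2 + u + 1) - 1) + u ^ 3" for x
    by (simp add: algebra_simps eval_nat_numeral)
  hence quad: "(x - u) * (x - u\<^sup>2) = x\<^sup>2 + x + 1" for x
    unfolding u[unfolded prim3_def] prim3_cube[OF u] by simp
  have "poly (cyclotomic_poly 3) ?w = (?w - u) * (?w - u\<^sup>2)"
    unfolding cyclotomic_poly_def coprime_index_sets poly_prod omega3_eq u_def[symmetric] by simp
  also have "\<dots> = ?w\<^sup>2 + ?w + 1" by (rule quad)
  finally show "poly (cyclotomic_poly 3) ?w = eval_int_poly Phi3 ?w"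
    by (simp add: algebra_simps power2_eq_square)
  have 1: "(x - z) * (x - z ^ 4) = x\<^sup>2 - (z + z ^ 4) * x + 1" for x
    using prim5_pow5[OF z] by (simp add: algebra_simps eval_nat_numeral)
  have 2: "(x - z\<^sup>2) * (x - z ^ 3) = x\<^sup>2 + (1 + (z + z ^ 4)) * x + 1" for x
  proof -
    have "(x - z\<^sup>2) * (x - z ^ 3) = x\<^sup>2 - ((z ^ 4 + z ^ 3 + z\<^sup>2 + z + 1) - 1 - (z + z ^ 4)) * x + z ^ 5"
      by (simp add: algebra_simps eval_nat_numeral)
    thus ?thesis unfolding z[unfolded prim5_def] prim5_pow5[OF z] by (simp add: algebra_simps)
  qed
  have 3: "(x\<^sup>2 - t * x + 1) * (x\<^sup>2 + (1 + t) * x + 1) = x ^ 4 + x ^ 3 + x\<^sup>2 + x + 1"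
    if "t\<^sup>2 = 1 - t" for t x :: complex
  proof -
    have "(x\<^sup>2 - t * x + 1) * (x\<^sup>2 + (1 + t) * x + 1) = x ^ 4 + x ^ 3 + (2 - t - t\<^sup>2) * x\<^sup>2 + x + 1"
      by (simp add: algebra_simps eval_nat_numeral)
    thus ?thesis unfolding that by simp
  qed
  have "poly (cyclotomic_poly 5) ?w = ((?w - z) * (?w - z ^ 4)) * ((?w - z\<^sup>2) * (?w - z ^ 3))"
    unfolding cyclotomic_poly_def coprime_index_sets poly_prod omega5_eq z_def[symmetric]
    by (simp add: mult_ac)
  also have "\<dots> = ?w ^ 4 + ?w ^ 3 + ?w\<^sup>2 + ?w + 1"
    unfolding 1 2 by (rule 3[OF prim5_tau[OF z]])
  finally show "poly (cyclotomic_poly 5) ?w = eval_int_poly Phi5 ?w"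
    by (simp add: algebra_simps eval_nat_numeral)
qed

lemma good_mult_unit15:
  assumes "good (eval_int_poly (V * F) (omega 15))" "unit15 V"
  shows "good (eval_int_poly F (omega 15))"
proof -
  let ?R = "int_adjoin (omega 15)" and ?e = "\<lambda>P. eval_int_poly P (omega 15)"
  obtain U where U: "?e V * ?e U = 1" using assms(2) by (auto simp: unit15_def)
  obtain u j s g where u: "unit_of_subring ?R u" and js: "j < 15" "s \<in> {1, - 1}"
    and e: "?e (V * F) = u * poly (good_poly j s g) (omega 15)"
    using assms(1) unfolding good_def by blast
  obtain P P' where P: "u = ?e P" "u * ?e P' = 1"
    using u by (auto simp: unit_of_subring_def int_adjoin_def)
  have "(?e U * u) * ?e (V * P') = (?e V * ?e U) * (u * ?e P')" by (simp only: eval_int_poly_mult mult_ac)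
  hence 1: "(?e U * u) * ?e (V * P') = 1" using U P(2) by simp
  have "?e U * u = ?e (U * P)" by (simp add: P(1) eval_int_poly_mult)
  hence "unit_of_subring ?R (?e U * u)" using 1 unfolding unit_of_subring_def int_adjoin_def by blast
  moreover have "?e F = (?e U * u) * poly (good_poly j s g) (omega 15)"
  proof -
    have "?e F = (?e V * ?e U) * ?e F" by (simp add: U)
    also have "\<dots> = ?e U * ?e (V * F)" by (simp only: eval_int_poly_mult mult_ac)
    finally show ?thesis by (simp only: e mult.assoc)
  qed
  moreover have "?e F \<in> ?R" by (auto simp: int_adjoin_def)
  ultimately show ?thesis using js unfolding good_def by blast
qed

text \<open>\<open>G\<close> is the good polynomial with \<open>g = 0\<close>. It meets both
  congruences because \<open>x ^ 5 - 1\<close> is 0 modulo \<open>Phi5\<close> and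
  \<open>x ^ 2 - 1\<close> modulo \<open>Phi3\<close>; \<open>cong15_both\<close> then supplies
  \<open>g\<close>.\<close>

lemma good_if_cong15:
  assumes 5: "cong15 Phi5 F ([:s:] * ([:0, 1:] ^ j * Phi3))" and 3: "cong15 Phi3 F [:-1, 0, 1:]"
    and s: "s \<in> {1, -1}"
  shows "good (eval_int_poly F (omega 15))"
proof -
  let ?w = "omega 15" and ?e = "\<lambda>P. eval_int_poly P (omega 15)"
  define G where "G = [:-1, 0, 0, 0, 0, 1:] + [:s:] * ([:0, 1:] ^ j * Phi3)"
  have "cong15 Phi5 (0 + [:s:] * ([:0, 1:] ^ j * Phi3)) G"
    unfolding G_def by (intro cong15_add cong15_refl cong15_sym[OF cong15_Phi5I[of _ "[:-1, 1:]" 0]]) simp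
  hence G5: "cong15 Phi5 F G" using cong15_trans[OF 5] by simp
  have "cong15 Phi3 ([:-1, 0, 1:] + 0) G"
    unfolding G_def
  proof (rule cong15_add; rule cong15_sym)
    show "cong15 Phi3 [:-1, 0, 0, 0, 0, 1:] [:-1, 0, 1:]"
      by (rule cong15_Phi3I[of _ "[:0, 0, -1, 1:]" 0]) simp
    have "[:s:] * ([:0, 1:] ^ j * Phi3) = Phi3 * ([:s:] * [:0, 1:] ^ j)" by (simp only: mult_ac)
    thus "cong15 Phi3 ([:s:] * ([:0, 1:] ^ j * Phi3)) 0" by (simp only: cong15_modulus)
  qed
  hence G3: "cong15 Phi3 F G" using cong15_trans[OF 3] by simp
  obtain g where g: "?e F - ?e G = ?e ([:-1, 1:] * Phi3 * Phi5) * ?e g"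
    using cong15_both[OF G5 G3] by (auto simp only: cong15_def)
  \<comment> \<open>Goodness asks for an exponent below 15.\<close>
  have wj: "?w ^ j = ?w ^ (j mod 15)" by (rule omega15_power_mod)
  have "poly (good_poly (j mod 15) s g) ?w = ?e G + ?e ([:-1, 1:] * Phi3 * Phi5) * ?e g"
  proof -
    have "?e G = (?w ^ 5 - 1) + of_int s * (?w ^ (j mod 15) * ?e Phi3)"
    proof -
      have "?e [:-1, 0, 0, 0, 0, 1:] = ?w ^ 5 - 1" by (simp add: eval_nat_numeral)
      moreover have "?e [:s:] = of_int s" "?e [:0, 1:] = ?w" by simp_all
      ultimately show ?thesis
        by (simp only: G_def eval_int_poly_add eval_int_poly_mult eval_int_poly_power wj)
    qed
    moreover have "?e ([:-1, 1:] * Phi3 * Phi5) = (?w - 1) * ?e Phi3 * ?e Phi5"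
    proof -
      have "?e [:-1, 1:] = ?w - 1" by simp
      thus ?thesis by (simp only: eval_int_poly_mult)
    qed
    moreover have "poly (of_int s) ?w = of_int s" by (simp add: of_int_poly)
    ultimately show ?thesis
      by (simp only: good_poly_def poly_add poly_diff poly_mult poly_monom poly_1 eval_cyclotomic_poly
          mult_1 power_one_right eval_int_poly_def[symmetric] mult.assoc)
  qed
  hence "?e F = 1 * poly (good_poly (j mod 15) s g) ?w"
    unfolding g[symmetric] by (metis add.commute diff_add_cancel mult_1)
  moreover have R: "?e P \<in> int_adjoin ?w" for P by (auto simp: int_adjoin_def)
  moreover have "unit_of_subring (int_adjoin ?w) 1" using R[of 1] by (auto simp: unit_of_subring_def)
  moreover have "j mod 15 < 15" by simp
  ultimately show ?thesis using s unfolding good_def by blast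
qed

text \<open>The golden unit first adjusts \<open>F\<close> modulo \<open>Phi5\<close>, scaling it by
  a power of 3 modulo \<open>Phi3\<close>. Then \<open>W\<close> adjusts modulo \<open>Phi3\<close>;
  there \<open>mixed_unit\<close> acts as 3, while modulo \<open>Phi5\<close> it acts as
  \<open>x ^ 4\<close>, so the first adjustment survives up to sign and a power of
  \<open>x\<close>.\<close>

lemma good_if_norms:
  assumes F3: "F = Phi3 * Q + [:b0, b1:]" and F5: "F = Phi5 * Q' + [:a0, a1, a2, a3:]"
    and n3: "(b0\<^sup>2 - b0 * b1 + b1\<^sup>2) mod 5 \<in> {2, 3}" and n5: "norm5 a0 a1 a2 a3 mod 3 = 1"
  shows "good (eval_int_poly F (omega 15))"
proof -
  obtain k j s where s: "s \<in> {1, -1}"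
    and k5: "cong15 Phi5 (F * golden_unit ^ k) ([:s:] * ([:0, 1:] ^ j * Phi3))"
    using norm5_mod_3_eq_1[OF F5 n5] by blast
  have c3: "cong15 Phi3 F [:b0, b1:]"
    by (rule cong15_Phi3I[of _ Q 0]) (simp only: F3 mult_zero_right add_0_right)
  have "cong15 Phi3 (F * golden_unit ^ k) ([:b0, b1:] * [:3:] ^ k)"
    by (intro cong15_mult cong15_power c3 golden_unit_mod_Phi3)
  also have "[:b0, b1:] * [:3:] ^ k = [:3 ^ k * b0, 3 ^ k * b1:]"
    by (simp add: poly_const_pow mult_ac)
  finally have k3: "cong15 Phi3 (F * golden_unit ^ k) [:3 ^ k * b0, 3 ^ k * b1:]" .
  have "((3 ^ k * b0)\<^sup>2 - (3 ^ k * b0) * (3 ^ k * b1) + (3 ^ k * b1)\<^sup>2) mod 5 \<in> {2, 3}"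
  proof -
    \<comment> \<open>Each factor 9 is -1 modulo 5 and exchanges 2 and 3.\<close>
    have "(9 ^ k * n) mod 5 \<in> {2, 3}" if "n mod 5 \<in> {2, 3}" for n :: int
    proof (induction k)
      case (Suc k)
      have "x mod 5 \<in> {2, 3} \<Longrightarrow> (9 * x) mod 5 \<in> {2, 3}" for x :: int by auto presburger+
      from this[OF Suc] show ?case by (simp add: mult_ac)
    qed (use that in simp)
    moreover have "(3 ^ k * b0)\<^sup>2 - (3 ^ k * b0) * (3 ^ k * b1) + (3 ^ k * b1)\<^sup>2
        = 9 ^ k * (b0\<^sup>2 - b0 * b1 + b1\<^sup>2)"
    proof -
      have "(9 :: int) ^ k = 3 ^ k * 3 ^ k" by (simp flip: power_mult_distrib)
      thus ?thesis by (simp add: power2_eq_square algebra_simps)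
    qed
    ultimately show ?thesis using n3 by simp
  qed
  from norm3_mod_5_eq_2_3[OF this] obtain l i s' where s': "s' \<in> {1, -1}"
    and l3: "cong15 Phi3 ([:3 ^ k * b0, 3 ^ k * b1:] * ([:s':] * [:3:] ^ l * [:0, 1:] ^ i)) [:-1, 0, 1:]"
    by blast
  define W where "W = [:s':] * mixed_unit ^ l * [:0, 1:] ^ i"
  have us: "unit15 [:s':]" using s' unit15_1 unit15_uminus[OF unit15_1] by (auto simp: one_pCons)
  have W: "unit15 W" unfolding W_def
    by (intro unit15_mult unit15_power us unit15_mixed unit15_x)
  have "cong15 Phi3 (F * golden_unit ^ k * W) ([:3 ^ k * b0, 3 ^ k * b1:] * ([:s':] * [:3:] ^ l * [:0, 1:] ^ i))"
    unfolding W_def by (intro cong15_mult cong15_power cong15_refl k3 mixed_unit_mod_Phi3)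
  from cong15_trans[OF this l3] have A3: "cong15 Phi3 (F * golden_unit ^ k * W) [:-1, 0, 1:]" .
  have x4: "[:0, 0, 0, 0, 1:] = [:0, 1 :: int:] ^ 4" by (simp add: eval_nat_numeral)
  have "cong15 Phi5 (F * golden_unit ^ k * W)
      (([:s:] * ([:0, 1:] ^ j * Phi3)) * ([:s':] * ([:0, 1:] ^ 4) ^ l * [:0, 1:] ^ i))"
    unfolding W_def
    by (intro cong15_mult cong15_power cong15_refl k5 mixed_unit_mod_Phi5[unfolded x4])
  also have "([:s:] * ([:0, 1:] ^ j * Phi3)) * ([:s':] * ([:0, 1:] ^ 4) ^ l * [:0, 1:] ^ i)
      = ([:s:] * [:s':]) * (([:0, 1:] ^ j * [:0, 1:] ^ (4 * l) * [:0, 1:] ^ i) * Phi3)"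
    unfolding power_mult by (simp only: mult_ac)
  also have "\<dots> = [:s * s':] * ([:0, 1:] ^ (j + 4 * l + i) * Phi3)"
  proof -
    have "[:s:] * [:s':] = [:s * s':]" by simp
    thus ?thesis by (simp only: power_add)
  qed
  finally have A5: "cong15 Phi5 (F * golden_unit ^ k * W) ([:s * s':] * ([:0, 1:] ^ (j + 4 * l + i) * Phi3))" .
  have "good (eval_int_poly (F * golden_unit ^ k * W) (omega 15))"
    by (rule good_if_cong15[OF A5 A3]) (use s s' in auto)
  hence "good (eval_int_poly ((golden_unit ^ k * W) * F) (omega 15))" by (simp only: mult_ac)
  thus ?thesis by (rule good_mult_unit15) (intro unit15_mult unit15_power unit15_golden W)
qed

subsection \<open>The theorem\<close>

lemma multiplicity_int_nat: "multiplicity (int p) (int n) = multiplicity p n"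
proof -
  have "int p ^ k dvd int n \<longleftrightarrow> p ^ k dvd n" for k
    by (metis int_dvd_int_iff of_nat_power)
  thus ?thesis by (auto simp: multiplicity_def)
qed

text \<open>Otherwise some prime of odd multiplicity is 2 or 3 modulo 5; being also 1 modulo 3, it
  is 7 or 13 modulo 15. The factor \<open>e\<close> allows for a ramified 3.\<close>

lemma norm3_residue_mod_5:
  fixes n :: int
  assumes n3: "b0\<^sup>2 - b0 * b1 + b1\<^sup>2 = e * n" and e: "e \<in> {1, 3}"
    and n: "n > 0" "\<not> 3 dvd n" "\<not> 5 dvd n"
    and no: "\<And>p. prime p \<Longrightarrow> [p = 7] (mod 15) \<or> [p = 13] (mod 15) \<Longrightarrow> \<not> int p dvd e * n"
  shows "n mod 5 \<in> {1, 4}"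
proof (rule ccontr)
  assume c: "n mod 5 \<notin> {1, 4}"
  \<comment> \<open>The class 0 is included so that every square satisfies \<open>S\<close>.\<close>
  define S where "S = (\<lambda>x::nat. x mod 5 \<in> {0, 1, 4})"
  have mult: "S (a * b)" if "S a" "S b" for a b
  proof -
    have "(a * b) mod 5 = (a mod 5) * (b mod 5) mod 5" by (simp add: mod_mult_eq)
    thus ?thesis using that by (auto simp: S_def)
  qed
  have sq: "S (a * a)" for a
  proof -
    have "(a * a) mod 5 = (a mod 5) * (a mod 5) mod 5" by (simp add: mod_mult_eq)
    moreover have "a mod 5 \<in> {0, 1, 2, 3, 4}" by auto
    ultimately show ?thesis by (auto simp: S_def)
  qed
  have "int (nat n mod 5) = n mod 5" using n(1) by (simp add: zmod_int)
  moreover have "n mod 5 \<noteq> 0" using n(3) by auto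
  ultimately have "\<not> S (nat n)" using c by (auto simp: S_def)
  then obtain p where p: "prime p" "odd (multiplicity p (nat n))" "\<not> S p"
    using odd_multiplicity_prime_outside_subgroup[of "nat n" S] n(1) mult sq by (auto simp: S_def)
  have m: "odd (multiplicity (int p) n)"
    using p(2) n(1) multiplicity_int_nat[of p "nat n"] by simp
  have pn: "int p dvd n" using m not_dvd_imp_multiplicity_0 by force
  have p3: "p \<noteq> 3" using pn n(2) by auto
  have "\<not> int p dvd e"
  proof -
    have "\<not> p dvd 3" using p3 p(1) primes_dvd_imp_eq[of p 3] by auto
    hence "\<not> int p dvd 3" using int_dvd_int_iff[of p 3] by simp
    thus ?thesis using e p(1) by auto
  qed
  hence "multiplicity (int p) (e * n) = multiplicity (int p) n"
    using p(1) n(1) e prime_elem_multiplicity_mult_distrib[of "int p" e n]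
    by (auto simp: not_dvd_imp_multiplicity_0)
  hence "[p = 1] (mod 3)" using odd_multiplicity_norm3[OF p(1) p3, of b0 b1] m n3 by simp
  moreover have "p mod 5 = 2 \<or> p mod 5 = 3" using p(3) by (auto simp: S_def)
  moreover have "\<forall>r<15::nat. r mod 3 = 1 \<and> (r mod 5 = 2 \<or> r mod 5 = 3) \<longrightarrow> r = 7 \<or> r = 13" by code_simp
  ultimately have "p mod 15 = 7 \<or> p mod 15 = 13"
    by (simp add: cong_def mod_mod_cancel)
  hence "\<not> int p dvd e * n" by (intro no p(1)) (simp add: cong_def)
  thus False using pn by simp
qed

text \<open>Same argument: a prime that is 2 modulo 3 and 1 modulo 5 is 11 modulo 15.\<close>

lemma norm5_residue_mod_3:
  fixes n :: int
  assumes n5: "norm5 a0 a1 a2 a3 = e * n" and e: "e \<in> {1, 5}"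
    and n: "n > 0" "\<not> 3 dvd n" "\<not> 5 dvd n"
    and no: "\<And>p. prime p \<Longrightarrow> [p = 11] (mod 15) \<Longrightarrow> \<not> int p dvd e * n"
  shows "n mod 3 = 1"
proof (rule ccontr)
  assume c: "n mod 3 \<noteq> 1"
  define S where "S = (\<lambda>x::nat. x mod 3 \<in> {0, 1})"
  have mult: "S (a * b)" if "S a" "S b" for a b
  proof -
    have "(a * b) mod 3 = (a mod 3) * (b mod 3) mod 3" by (simp add: mod_mult_eq)
    thus ?thesis using that by (auto simp: S_def)
  qed
  have sq: "S (a * a)" for a
  proof -
    have "(a * a) mod 3 = (a mod 3) * (a mod 3) mod 3" by (simp add: mod_mult_eq)
    moreover have "a mod 3 \<in> {0, 1, 2}" by auto
    ultimately show ?thesis by (auto simp: S_def)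
  qed
  have "int (nat n mod 3) = n mod 3" using n(1) by (simp add: zmod_int)
  moreover have "n mod 3 \<noteq> 0" using n(2) by auto
  ultimately have "\<not> S (nat n)" using c by (auto simp: S_def)
  then obtain p where p: "prime p" "odd (multiplicity p (nat n))" "\<not> S p"
    using odd_multiplicity_prime_outside_subgroup[of "nat n" S] n(1) mult sq by (auto simp: S_def)
  have m: "odd (multiplicity (int p) n)"
    using p(2) n(1) multiplicity_int_nat[of p "nat n"] by simp
  have pn: "int p dvd n" using m not_dvd_imp_multiplicity_0 by force
  have p5: "p \<noteq> 5" using pn n(3) by auto
  have "\<not> int p dvd e"
  proof -
    have "\<not> p dvd 5" using p5 p(1) primes_dvd_imp_eq[of p 5] by auto
    hence "\<not> int p dvd 5" using int_dvd_int_iff[of p 5] by simp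
    thus ?thesis using e p(1) by auto
  qed
  hence "multiplicity (int p) (e * n) = multiplicity (int p) n"
    using p(1) n(1) e prime_elem_multiplicity_mult_distrib[of "int p" e n]
    by (auto simp: not_dvd_imp_multiplicity_0)
  hence "[p = 1] (mod 5)" using odd_multiplicity_norm5[OF p(1) p5, of a0 a1 a2 a3] m n5 by simp
  moreover have "p mod 3 = 2" using p(3) by (auto simp: S_def)
  moreover have "\<forall>r<15::nat. r mod 3 = 2 \<and> r mod 5 = 1 \<longrightarrow> r = 11" by code_simp
  ultimately have "p mod 15 = 11"
    by (simp add: cong_def mod_mod_cancel)
  hence "\<not> int p dvd e * n" by (intro no p(1)) (simp add: cong_def)
  thus False using pn by simp
qed

lemma even_multiplicity_square_dvd:
  fixes p n :: int
  assumes "p dvd n" "even (multiplicity p n)" "n \<noteq> 0" "prime p"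
  shows "p\<^sup>2 dvd n"
proof -
  have "multiplicity p n \<ge> 1" using assms by (intro multiplicity_geI) auto
  hence "2 \<le> multiplicity p n" using assms(2) by presburger
  thus ?thesis by (rule multiplicity_dvd')
qed

theorem theorem4:
  fixes F :: "int poly" and m :: int
  assumes "M_prod 15 F = of_int (3 ^ 2 * m) \<or> M_prod 15 F = of_int (5 ^ 2 * m)"
    and "gcd 15 m = 1"
  shows "(\<exists>k::int. N_prod 15 F = of_int k \<and> norm_good_15 k)
    \<or> (\<exists>(p::nat) (k::int). prime p \<and> ([p = 7] (mod 15) \<or> [p = 13] (mod 15)) \<and>
          N_prod 3 F = of_int k \<and> int p dvd k)
    \<or> (\<exists>(p::nat) (k::int). prime p \<and> [p = 11] (mod 15) \<and>
          N_prod 5 F = of_int k \<and> int p dvd k)"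
proof (rule ccontr)
  assume "\<not> ?thesis"
  hence no15: "\<And>k. N_prod 15 F = of_int k \<Longrightarrow> \<not> norm_good_15 k"
    and no3: "\<And>p k. prime p \<Longrightarrow> [p = 7] (mod 15) \<or> [p = 13] (mod 15) \<Longrightarrow> N_prod 3 F = of_int k \<Longrightarrow> \<not> int p dvd k"
    and no5: "\<And>p k. prime p \<Longrightarrow> [p = 11] (mod 15) \<Longrightarrow> N_prod 5 F = of_int k \<Longrightarrow> \<not> int p dvd k"
    by blast+
  obtain Q b0 b1 where F3: "F = Phi3 * Q + [:b0, b1:]" using remainder_Phi3 by blast
  obtain Q' a0 a1 a2 a3 where F5: "F = Phi5 * Q' + [:a0, a1, a2, a3:]" using remainder_Phi5 by blast
  define f where "f = poly F 1"
  define n3 where "n3 = b0\<^sup>2 - b0 * b1 + b1\<^sup>2"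
  define n5 where "n5 = norm5 a0 a1 a2 a3"
  note N = norm_integers[OF F3 F5, folded n3_def n5_def f_def]
  obtain n15 where n15: "N_prod 15 F = of_int n15" "[n15 = n5\<^sup>2] (mod 3)" "[n15 = n3 ^ 4] (mod 5)"
    using N(5) by blast
  have "of_int (f * n3 * n5 * n15) = M_prod 15 F"
    by (simp add: M_prod_15 N(1,2) n15(1) f_def)
  then have M: "f * n3 * n5 * n15 = 9 * m \<or> f * n3 * n5 * n15 = 25 * m"
    using assms(1)[folded \<open>of_int (f * n3 * n5 * n15) = M_prod 15 F\<close>] unfolding of_int_eq_iff by simp
  have m: "\<not> 3 dvd m" "\<not> 5 dvd m"
    using assms(2) gcd_greatest[of 3 15 m] gcd_greatest[of 5 15 m] by auto
  have m0: "m \<noteq> 0" using m by auto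
  have prod0: "f * n3 * n5 * n15 \<noteq> 0" using M m0 by auto
  have pos: "n3 > 0" "n5 > 0" using N(6,7) prod0 by (auto simp: less_le)
  have d3: "3 dvd n3 \<longleftrightarrow> 3 dvd f" "3 dvd n15 \<longleftrightarrow> 3 dvd n5"
    using cong_dvd_iff[OF N(3)] cong_dvd_iff[OF n15(2)] by (simp_all add: prime_dvd_power_iff)
  have d5: "5 dvd n5 \<longleftrightarrow> 5 dvd f" "5 dvd n15 \<longleftrightarrow> 5 dvd n3"
    using cong_dvd_iff[OF N(4)] cong_dvd_iff[OF n15(3)] by (simp_all add: prime_dvd_power_iff)
  have p3: "3 dvd f * n3 * n5 * n15 \<longleftrightarrow> 3 dvd f \<or> 3 dvd n3 \<or> 3 dvd n5 \<or> 3 dvd n15"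
    by (simp add: prime_dvd_mult_iff)
  have p5: "5 dvd f * n3 * n5 * n15 \<longleftrightarrow> 5 dvd f \<or> 5 dvd n3 \<or> 5 dvd n5 \<or> 5 dvd n15"
    by (simp add: prime_dvd_mult_iff)
  \<comment> \<open>It thus remains to show that \<open>n15\<close> is prime to 15 and
    \<open>F\<close> is good at \<open>omega 15\<close>.\<close>
  have cop: "\<not> good (eval_int_poly F (omega 15))" if "\<not> 3 dvd n15" "\<not> 5 dvd n15"
  proof
    assume g: "good (eval_int_poly F (omega 15))"
    have "coprime n15 3" "coprime n15 5"
      using that prime_imp_coprime[of 3 n15] prime_imp_coprime[of 5 n15]
      by (simp_all add: coprime_commute)
    hence "coprime n15 (3 * 5)" by (simp only: coprime_mult_right_iff)
    hence "norm_good_15 n15"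
      using g field_norm_omega15[of F] n15(1) by (auto simp: norm_good_15_def)
    thus False using no15 n15(1) by blast
  qed
  have no3': "\<And>p. prime p \<Longrightarrow> [p = 7] (mod 15) \<or> [p = 13] (mod 15) \<Longrightarrow> \<not> int p dvd n3"
    using no3 N(1) by blast
  have no5': "\<And>p. prime p \<Longrightarrow> [p = 11] (mod 15) \<Longrightarrow> \<not> int p dvd n5"
    using no5 N(2) by blast
  from M show False
  proof
    assume M: "f * n3 * n5 * n15 = 9 * m"
    have "\<not> 5 dvd 9 * m" using m(2) by presburger
    hence 5: "\<not> 5 dvd f" "\<not> 5 dvd n3" "\<not> 5 dvd n5" "\<not> 5 dvd n15" using p5 M by auto
    have n27: "\<not> 27 dvd f * n3 * n5 * n15" unfolding M using m(1) by presburger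
    have 3: "\<not> 3 dvd n5"
    proof
      assume 3: "3 dvd n5"
      \<comment> \<open>3 is not 1 modulo 5, so \<open>n5\<close> would contain 9; with the 3 in
        \<open>n15\<close> this exceeds the available power of 3.\<close>
      have "even (multiplicity 3 n5)"
        using odd_multiplicity_norm5[of 3 a0 a1 a2 a3] by (auto simp: n5_def cong_def)
      hence "3\<^sup>2 dvd n5" using even_multiplicity_square_dvd[of 3 n5] 3 pos(2) by simp
      hence "3\<^sup>2 * 3 dvd n5 * n15" using 3 d3(2) by (intro mult_dvd_mono) auto
      hence "27 dvd (f * n3) * (n5 * n15)" by (intro dvd_mult[of _ "n5 * n15"]) simp
      thus False using n27 by (simp add: mult.assoc)
    qed
    have h3: "\<not> 3 dvd n15" using 3 d3(2) by simp
    have "3 dvd 9 * m" by presburger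
    \<comment> \<open>The two factors 3 are thus shared by \<open>f\<close> and \<open>n3\<close>,
      one each.\<close>
    hence f3: "3 dvd f" "3 dvd n3" using p3 M 3 h3 d3(1) by auto
    then obtain n where n: "n3 = 3 * n" by (elim dvdE)
    have "\<not> 3 dvd n"
    proof
      assume "3 dvd n"
      hence "3 * (3 * 3) dvd f * n3" unfolding n using f3(1) by (intro mult_dvd_mono) auto
      hence "27 dvd f * n3 * (n5 * n15)" by (intro dvd_mult2[of _ "f * n3"]) simp
      thus False using n27 by (simp add: mult.assoc)
    qed
    moreover have "\<not> 5 dvd n" using 5(2) n by auto
    ultimately have "n mod 5 \<in> {1, 4}"
      using norm3_residue_mod_5[of b0 b1 3 n] n no3' pos(1) by (simp add: n3_def)
    \<comment> \<open>Multiplication by 3 turns the residues 1, 4 into 3, 2.\<close>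
    hence "n3 mod 5 \<in> {2, 3}" unfolding n by auto presburger+
    moreover have "n5 mod 3 = 1"
      using norm5_residue_mod_3[of a0 a1 a2 a3 1 n5] 3 5(3) pos(2) no5' by (simp add: n5_def)
    ultimately have "good (eval_int_poly F (omega 15))"
      using good_if_norms[OF F3 F5] by (simp only: n3_def n5_def)
    thus False using cop h3 5(4) by blast
  next
    assume M: "f * n3 * n5 * n15 = 25 * m"
    have "\<not> 3 dvd 25 * m" using m(1) by presburger
    hence 3: "\<not> 3 dvd f" "\<not> 3 dvd n3" "\<not> 3 dvd n5" "\<not> 3 dvd n15" using p3 M by auto
    have n125: "\<not> 125 dvd f * n3 * n5 * n15" unfolding M using m(2) by presburger
    have 5: "\<not> 5 dvd n3"
    proof
      assume 5: "5 dvd n3"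
      \<comment> \<open>5 is not 1 modulo 3, so \<open>n3\<close> would contain 25, and
        \<open>n15\<close> another 5.\<close>
      have "even (multiplicity 5 n3)"
        using odd_multiplicity_norm3[of 5 b0 b1] by (auto simp: n3_def cong_def)
      hence "5\<^sup>2 dvd n3" using even_multiplicity_square_dvd[of 5 n3] 5 pos(1) by simp
      hence "5\<^sup>2 * 5 dvd n3 * n15" using 5 d5(2) by (intro mult_dvd_mono) auto
      hence "125 dvd (f * n5) * (n3 * n15)" by (intro dvd_mult[of _ "n3 * n15"]) simp
      thus False using n125 by (simp add: mult_ac)
    qed
    have h5: "\<not> 5 dvd n15" using 5 d5(2) by simp
    have "5 dvd 25 * m" by presburger
    hence f5: "5 dvd f" "5 dvd n5" using p5 M 5 h5 d5(1) by auto
    then obtain n where n: "n5 = 5 * n" by (elim dvdE)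
    have "\<not> 5 dvd n"
    proof
      assume "5 dvd n"
      hence "5 * (5 * 5) dvd f * n5" unfolding n using f5(1) by (intro mult_dvd_mono) auto
      hence "125 dvd f * n5 * (n3 * n15)" by (intro dvd_mult2[of _ "f * n5"]) simp
      thus False using n125 by (simp add: mult_ac)
    qed
    moreover have "\<not> 3 dvd n" using 3(3) n by auto
    ultimately have "n mod 3 = 1"
      using norm5_residue_mod_3[of a0 a1 a2 a3 5 n] n no5' pos(2) by (simp add: n5_def)
    \<comment> \<open>The norm is 2 modulo 3; the extra factor 5 will come from
      \<open>x - 1\<close>.\<close>
    hence n5: "5 * n5 mod 3 = 1" unfolding n by presburger
    have "n3 mod 5 \<in> {1, 4}"
      using norm3_residue_mod_5[of b0 b1 1 n3] 3(2) 5 pos(1) no3' by (simp add: n3_def)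
    hence n3: "3 * n3 mod 5 \<in> {2, 3}" by auto presburger+
    \<comment> \<open>Multiplying by \<open>x - 1\<close>, a unit at \<open>\<omega>\<^sub>1\<^sub>5\<close> of norms 3 and 5 at \<open>\<omega>\<^sub>3\<close> and \<open>\<omega>\<^sub>5\<close>, leads back to the residues of the first case.\<close>
    define F' where "F' = [:-1, 1:] * F"
    obtain R c0 c1 where F3': "F' = Phi3 * R + [:c0, c1:]" using remainder_Phi3 by blast
    obtain R' e0 e1 e2 e3 where F5': "F' = Phi5 * R' + [:e0, e1, e2, e3:]" using remainder_Phi5 by blast
    have u: "prim3 (omega 15 ^ 5)" using prim3_omega15_power[of 1] by simp
    have z: "prim5 (omega 15 ^ 3)" using prim5_omega15_power[of 1] by simp
    have "eval_norm3 [:-1, 1:] (omega 15 ^ 5) = 3"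
      using eval_norm3_eq[OF u, of "[:-1, 1:]" 0 "-1" 1] by simp
    moreover have "eval_norm3 F' v = eval_norm3 [:-1, 1:] v * eval_norm3 F v" for v
      unfolding F'_def eval_norm3_def eval_int_poly_mult by (simp only: mult_ac)
    ultimately have "complex_of_int (c0\<^sup>2 - c0 * c1 + c1\<^sup>2) = of_int (3 * n3)"
      using eval_norm3_eq[OF u F3'] N(1) by (simp add: N_prod_3)
    hence c: "c0\<^sup>2 - c0 * c1 + c1\<^sup>2 = 3 * n3" unfolding of_int_eq_iff .
    have "norm5 (-1) 1 0 0 = 5"
      by (simp add: norm5_def golden_norm_def real_part5_def tau_part5_def)
    hence "eval_norm5 [:-1, 1:] (omega 15 ^ 3) = 5"
      using eval_norm5_eq[OF z, of "[:-1, 1:]" 0 "-1" 1 0 0] by simp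
    moreover have "eval_norm5 F' v = eval_norm5 [:-1, 1:] v * eval_norm5 F v" for v
      unfolding F'_def eval_norm5_def eval_int_poly_mult by (simp only: mult_ac)
    ultimately have "complex_of_int (norm5 e0 e1 e2 e3) = of_int (5 * n5)"
      using eval_norm5_eq[OF z F5'] N(2) by (simp add: N_prod_5)
    hence e: "norm5 e0 e1 e2 e3 = 5 * n5" unfolding of_int_eq_iff .
    have "good (eval_int_poly F' (omega 15))"
      using good_if_norms[OF F3' F5'] n3 n5 unfolding c e by blast
    hence "good (eval_int_poly F (omega 15))"
      unfolding F'_def using good_mult_unit15 unit15_x_minus_1 by blast
    thus False using cop 3(4) h5 by blast
  qed
qed

end
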